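(* Let $n\ge 1$ be an integer and let $\alpha,\beta$ be real numbers with $\alpha>0$, $\beta>-1$ and $\frac{n-1}{n+1}\beta\le\alpha\le\beta+2$. Put $p^*=\frac{2n+2\beta+2}{n+\alpha-1}$. Then there is a constant $C_{n+1,\alpha,\beta}>0$ such that for all $u\in\mathcal{D}^{1,2}_\alpha(\mathbb{R}^{n+1}_+)$, $$\Big(\int_{\mathbb{R}^{n+1}_+}t^\beta|u|^{p^*}\,dy\,dt\Big)^{2/p^*}\le C_{n+1,\alpha,\beta}\int_{\mathbb{R}^{n+1}_+}t^\alpha|\nabla u|^2\,dy\,dt.$$
   Context: $\mathbb{R}^{n+1}_+=\{(y,t): y\in\mathbb{R}^n,\ t>0\}$. $C_0^\infty(\overline{\mathbb{R}^{n+1}_+})$ is the set of restrictions to $\overline{\mathbb{R}^{n+1}_+}$ of functions in $C_0^\infty(\mathbb{R}^{n+1})$. $\mathcal{D}^{1,2}_\alpha(\mathbb{R}^{n+1}_+)$ is the completion of $C_0^\infty(\overline{\mathbb{R}^{n+1}_+})$ under the norm $\big(\int_{\mathbb{R}^{n+1}_+}t^\alpha|\nabla u|^2\,dy\,dt\big)^{1/2}$. *)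

theory Defs
  imports "HOL-Analysis.Analysis"
begin

text \<open>
  Points of \<open>n+1\<close>-dimensional space are pairs \<open>x = (y, t)\<close> with \<open>y :: real ^ 'n\<close> and
  \<open>t = snd x\<close>, so \<open>n = CARD('n) \<ge> 1\<close>. The measure \<open>lborel\<close> on the product type is \<open>dy dt\<close>.
\<close>

definition half_space :: "((real ^ 'n) \<times> real) set" where
  "half_space = {x. snd x > 0}"

definition closed_half_space :: "((real ^ 'n) \<times> real) set" where
  "closed_half_space = {x. snd x \<ge> 0}"

primrec k_times_diff :: "nat \<Rightarrow> ('a::euclidean_space \<Rightarrow> real) \<Rightarrow> bool" where
  "k_times_diff 0 f \<longleftrightarrow> continuous_on UNIV f"
| "k_times_diff (Suc k) f \<longleftrightarrow>
     (\<forall>x. f differentiable (at x)) \<and>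
     (\<forall>v. k_times_diff k (\<lambda>x. frechet_derivative f (at x) v))"

definition smooth :: "('a::euclidean_space \<Rightarrow> real) \<Rightarrow> bool" where
  "smooth f \<longleftrightarrow> (\<forall>k. k_times_diff k f)"

definition C0_infinity :: "('a::euclidean_space \<Rightarrow> real) set" where
  "C0_infinity = {f. smooth f \<and> compact (closure {x. f x \<noteq> 0})}"

text \<open>
  The restriction of \<open>f\<close> to the closed half-space is encoded as a total function with value
  \<open>0\<close> elsewhere. These values are never used: gradients are only taken, and integrals only
  formed, on the open half-space.
\<close>

definition C0_infinity_half :: "((real ^ 'n) \<times> real \<Rightarrow> real) set" where
  "C0_infinity_half = (\<lambda>f x. if x \<in> closed_half_space then f x else 0) ` C0_infinity"

definition grad :: "('a::real_inner \<Rightarrow> real) \<Rightarrow> 'a \<Rightarrow> 'a" where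
  "grad f x = (THE D. GDERIV f x :> D)"

definition D12_norm :: "real \<Rightarrow> ((real ^ 'n) \<times> real \<Rightarrow> real) \<Rightarrow> real" where
  "D12_norm \<alpha> u = sqrt (LINT x:half_space|lborel. snd x powr \<alpha> * (norm (grad u x))\<^sup>2)"

text \<open>
  The completion \<open>D12 \<alpha>\<close> of \<open>C0_infinity_half\<close> under \<open>D12_norm \<alpha>\<close> is the set of Cauchy
  sequences modulo sequences that tend to \<open>0\<close> in norm.
\<close>

definition D12_Cauchy :: "real \<Rightarrow> (nat \<Rightarrow> (real ^ 'n) \<times> real \<Rightarrow> real) set" where
  "D12_Cauchy \<alpha> = {\<phi>. (\<forall>k. \<phi> k \<in> C0_infinity_half) \<and>
     (\<forall>e>0. \<exists>N. \<forall>j\<ge>N. \<forall>k\<ge>N. D12_norm \<alpha> (\<lambda>x. \<phi> j x - \<phi> k x) < e)}"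

definition D12_equiv ::
  "real \<Rightarrow> ((nat \<Rightarrow> (real ^ 'n) \<times> real \<Rightarrow> real) \<times> (nat \<Rightarrow> (real ^ 'n) \<times> real \<Rightarrow> real)) set" where
  "D12_equiv \<alpha> = {(\<phi>, \<psi>). \<phi> \<in> D12_Cauchy \<alpha> \<and> \<psi> \<in> D12_Cauchy \<alpha> \<and>
     (\<lambda>k. D12_norm \<alpha> (\<lambda>x. \<phi> k x - \<psi> k x)) \<longlonglongrightarrow> 0}"

definition D12 :: "real \<Rightarrow> (nat \<Rightarrow> (real ^ 'n) \<times> real \<Rightarrow> real) set set" where
  "D12 \<alpha> = D12_Cauchy \<alpha> // D12_equiv \<alpha>"

text \<open>
  An element \<open>U\<close> of the completion is regarded as a function on the half-space: the limit, in
  \<open>L\<^sup>1\<close> on every compact subset of the open half-space, of the sequences in \<open>U\<close>. The limit is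
  unique almost everywhere, so it is irrelevant for integrals which one is chosen.
  For \<open>\<alpha> > 0\<close> it exists by Hardy's inequality.
\<close>

definition represents_fun ::
  "(nat \<Rightarrow> (real ^ 'n) \<times> real \<Rightarrow> real) set \<Rightarrow> ((real ^ 'n) \<times> real \<Rightarrow> real) \<Rightarrow> bool" where
  "represents_fun U u \<longleftrightarrow> set_borel_measurable lborel half_space u \<and>
     (\<forall>\<phi>\<in>U. \<forall>K. compact K \<and> K \<subseteq> half_space \<longrightarrow>
        (\<lambda>k. \<integral>\<^sup>+x\<in>K. ennreal \<bar>\<phi> k x - u x\<bar> \<partial>lborel) \<longlonglongrightarrow> 0)"

definition D12_fun ::
  "(nat \<Rightarrow> (real ^ 'n) \<times> real \<Rightarrow> real) set \<Rightarrow> (real ^ 'n) \<times> real \<Rightarrow> real" where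
  "D12_fun U = (SOME u. represents_fun U u)"

text \<open>
  The gradient extends from \<open>C0_infinity_half\<close> to the completion as an isometry into
  the vector-valued \<open>L\<^sup>2\<close> space with weight \<open>t\<close> to the power \<open>\<alpha>\<close>. The value at \<open>U\<close>, determined
  almost everywhere, is the weak gradient of \<open>D12_fun U\<close>.
\<close>

definition represents_grad ::
  "real \<Rightarrow> (nat \<Rightarrow> (real ^ 'n) \<times> real \<Rightarrow> real) set \<Rightarrow>
     ((real ^ 'n) \<times> real \<Rightarrow> (real ^ 'n) \<times> real) \<Rightarrow> bool" where
  "represents_grad \<alpha> U g \<longleftrightarrow> set_borel_measurable lborel half_space g \<and>
     (\<forall>\<phi>\<in>U. (\<lambda>k. \<integral>\<^sup>+x\<in>half_space.
        ennreal (snd x powr \<alpha> * (norm (grad (\<phi> k) x - g x))\<^sup>2) \<partial>lborel) \<longlonglongrightarrow> 0)"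

definition D12_grad ::
  "real \<Rightarrow> (nat \<Rightarrow> (real ^ 'n) \<times> real \<Rightarrow> real) set \<Rightarrow> (real ^ 'n) \<times> real \<Rightarrow> (real ^ 'n) \<times> real" where
  "D12_grad \<alpha> U = (SOME g. represents_grad \<alpha> U g)"

end

theory Submission
  imports Defs
begin

text \<open>
  For \<open>u\<close> of class \<open>C\<^sup>1\<close> with compact support let \<open>E = \<integral> t\<^sup>\<alpha> |\<nabla>u|\<^sup>2\<close> and \<open>J(b) = \<integral> t\<^sup>b |u|\<^bsup>p(b)\<^esup>\<close>, where
  \<open>p(b) = (2n + 2b + 2) / (n + \<alpha> - 1)\<close> is affine in \<open>b\<close>; by Hoelder's inequality \<open>log J\<close> is convex in \<open>b\<close>.
  Along every coordinate line one has \<open>|u(x)|\<^sup>s \<le> s \<integral> |u|\<^bsup>s-1\<^esup> |\<nabla>u|\<close>. In the \<open>t\<close>-direction this gives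
  Hardy's inequality, and together with Cauchy-Schwarz \<open>J((c + \<alpha> - 2)/2) \<le> K (E J(c))\<^bsup>1/2\<^esup>\<close> for
  \<open>c > -\<alpha>\<close>. Integrating towards increasing \<open>t\<close>, a weight \<open>t\<^sup>a\<close> with \<open>a \<ge> 0\<close> can be moved inside the line
  integrals, so the argument of Gagliardo gives \<open>J((\<alpha> + c)(n+1)/(2n)) \<le> K (E J(c))\<^bsup>(n+1)/(2n)\<^esup>\<close>.
  In the admissible range \<open>c\<close> lies between these two exponents, and interpolation bounds \<open>J(c)\<close> by a
  constant times a power less than \<open>1\<close> of \<open>E J(c)\<close>; since \<open>J(c)\<close> is finite, it can be absorbed.
  The exponents \<open>-1 < b \<le> -\<alpha>\<close> follow from one more application of Hardy's inequality and
  interpolation. The inequality makes Cauchy sequences for the norm of \<open>D12\<close> converge in the weighted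
  \<open>L\<^sup>p\<close> space, hence in \<open>L\<^sup>1\<close> on compact sets, and passes to the limit.
\<close>

section \<open>Real powers of extended nonnegative reals and the Hoelder inequality\<close>

text \<open>Only used for \<open>r \<ge> 0\<close>; here \<open>0\<close> to the power \<open>0\<close> is \<open>1\<close>, unlike for \<^const>\<open>powr\<close>.\<close>

definition epowr :: "ennreal \<Rightarrow> real \<Rightarrow> ennreal" where
  "epowr x r = (if r = 0 then 1 else if x = top then top else ennreal (enn2real x powr r))"

lemma epowr_0 [simp]: "epowr x 0 = 1"
  by (simp add: epowr_def)

lemma epowr_1 [simp]: "epowr x 1 = x"
  by (cases x) (auto simp: epowr_def)

lemma epowr_ennreal: "0 \<le> x \<Longrightarrow> r \<noteq> 0 \<Longrightarrow> epowr (ennreal x) r = ennreal (x powr r)"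
  by (simp add: epowr_def)

lemma epowr_zero [simp]: "r \<noteq> 0 \<Longrightarrow> epowr 0 r = 0"
  by (simp add: epowr_def)

lemma epowr_one [simp]: "epowr 1 r = 1"
  by (simp add: epowr_def)

lemma epowr_top [simp]: "r \<noteq> 0 \<Longrightarrow> epowr top r = top"
  by (simp add: epowr_def)

lemma epowr_eq_0_iff: "epowr x r = 0 \<longleftrightarrow> x = 0 \<and> r \<noteq> 0"
  by (cases x) (auto simp: epowr_def)

lemma epowr_eq_top_iff: "epowr x r = top \<longleftrightarrow> x = top \<and> r \<noteq> 0"
  by (cases x) (auto simp: epowr_def)

lemma borel_measurable_epowr [measurable]:
  assumes [measurable]: "f \<in> borel_measurable M"
  shows "(\<lambda>x. epowr (f x) r) \<in> borel_measurable M"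
  unfolding epowr_def by measurable

text \<open>The convention \<open>0 * top = 0\<close> is respected, since a positive power of
  \<open>0\<close> is \<open>0\<close> and a positive power of \<open>top\<close> is
  \<open>top\<close>. These extreme values are split off and leave positive reals.\<close>

lemma epowr_mult:
  assumes "0 \<le> r"
  shows "epowr (x * y) r = epowr x r * epowr y r"
proof (cases "r = 0 \<or> x = 0 \<or> y = 0 \<or> x = top \<or> y = top")
  case True
  then show ?thesis
    by (cases "r = 0") (auto simp: ennreal_top_mult ennreal_mult_top epowr_eq_0_iff)
next
  case False
  then obtain a b where "0 < a" "0 < b" "x = ennreal a" "y = ennreal b"
    by (cases x; cases y) (auto simp: less_le)
  with False show ?thesis
    by (simp add: epowr_ennreal powr_mult ennreal_mult[symmetric])
qed

lemma epowr_add: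
  assumes "0 \<le> r" "0 \<le> s"
  shows "epowr x (r + s) = epowr x r * epowr x s"
proof (cases "r = 0 \<or> s = 0 \<or> x = top")
  case True
  with assms show ?thesis
    by (cases "r = 0"; cases "s = 0")
       (auto simp: ennreal_top_mult ennreal_mult_top epowr_eq_0_iff add_nonneg_eq_0_iff)
next
  case False
  with assms show ?thesis
    by (cases x) (auto simp: epowr_ennreal powr_add ennreal_mult)
qed

lemma epowr_epowr: "epowr (epowr x r) s = epowr x (r * s)"
  by (cases x; cases "r = 0 \<or> s = 0") (auto simp: epowr_ennreal powr_powr)

lemma epowr_mono:
  assumes "0 \<le> r" "x \<le> y"
  shows "epowr x r \<le> epowr y r"
proof (cases "r = 0 \<or> y = top")
  case True
  with assms show ?thesis by (auto simp: epowr_def)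
next
  case False
  then obtain b where "0 \<le> b" "y = ennreal b" by (cases y) auto
  moreover from this assms obtain a where "0 \<le> a" "x = ennreal a"
    by (cases x) (auto simp: top_unique)
  ultimately show ?thesis
    using assms False by (auto simp: epowr_ennreal intro!: ennreal_leI powr_mono2)
qed

lemma epowr_prod:
  assumes "0 \<le> r"
  shows "epowr (\<Prod>i\<in>I. f i) r = (\<Prod>i\<in>I. epowr (f i) r)"
  by (induction I rule: infinite_finite_induct) (auto simp: epowr_mult assms)

lemma prod_mono_ennreal:
  fixes f g :: "'i \<Rightarrow> ennreal"
  assumes "\<And>i. i \<in> I \<Longrightarrow> f i \<le> g i"
  shows "prod f I \<le> prod g I"
  using assms by (induction I rule: infinite_finite_induct) (auto intro: mult_mono)

lemma epowr_power: "0 \<le> r \<Longrightarrow> epowr x r ^ k = epowr x (real k * r)"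
  by (induction k) (auto simp: algebra_simps epowr_add)

lemma epowr_ennreal_pos: "0 < x \<Longrightarrow> epowr (ennreal x) r = ennreal (x powr r)"
  by (simp add: epowr_def)

text \<open>The crude bound \<open>x + y \<le> 2 * max x y\<close> stands in for convexity, so that
  one argument serves all exponents \<open>r \<ge> 0\<close>. Optimal constants are never
  tracked.\<close>

lemma epowr_add_le:
  assumes "0 \<le> r"
  shows "epowr (x + y) r \<le> ennreal (2 powr r) * (epowr x r + epowr y r)"
proof -
  have "epowr (x + y) r \<le> epowr (ennreal 2 * max x y) r"
    using assms by (intro epowr_mono) (auto simp: mult_2 intro!: add_mono)
  also have "\<dots> = ennreal (2 powr r) * epowr (max x y) r"
    by (subst epowr_mult[OF assms]) (simp add: epowr_def)
  also have "epowr (max x y) r \<le> epowr x r + epowr y r"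
    by (auto simp: max_def)
  finally show ?thesis by (simp add: mult_left_mono)
qed

lemma tendsto_epowr_0:
  assumes "(f \<longlongrightarrow> 0) F" "0 < r"
  shows "((\<lambda>x. epowr (f x) r) \<longlongrightarrow> 0) F"
proof (rule order_tendstoI)
  fix e :: ennreal
  assume "0 < e"
  then obtain d where d: "0 < ennreal d" "ennreal d < e"
    by (metis dense ennreal_cases less_top_ennreal order_less_trans)
  then have "0 < ennreal (d powr (1 / r))" by simp
  with assms(1) have "eventually (\<lambda>x. f x < ennreal (d powr (1 / r))) F"
    by (rule order_tendstoD)
  then show "eventually (\<lambda>x. epowr (f x) r < e) F"
  proof eventually_elim
    case (elim x)
    have "epowr (f x) r \<le> epowr (ennreal (d powr (1 / r))) r"
      using elim assms by (intro epowr_mono) auto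
    also have "\<dots> = ennreal d"
      using assms d by (simp add: epowr_ennreal powr_powr)
    finally show ?case using d by simp
  qed
qed simp

text \<open>Dividing by \<open>x\<close> to the power \<open>\<kappa>\<close> leaves
  \<open>x\<close> to the power \<open>1 - \<kappa>\<close>. Finiteness is essential here: for
  \<open>x = top\<close> and finite positive \<open>e\<close> the first hypothesis holds trivially
  and the conclusion fails.\<close>

lemma epowr_absorb:
  assumes x: "x \<le> ennreal K * epowr (e * x) \<kappa>" "x < top" and K: "0 < K" and \<kappa>: "0 < \<kappa>" "\<kappa> < 1"
  shows "x \<le> ennreal (K powr (1 / (1 - \<kappa>))) * epowr e (\<kappa> / (1 - \<kappa>))"
proof (cases "x = 0 \<or> e = top")
  case True
  with K \<kappa> show ?thesis by (auto simp: ennreal_mult_top)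
next
  case False
  with x(2) obtain y d where y: "x = ennreal y" "0 < y" and d: "e = ennreal d" "0 \<le> d"
    by (cases x; cases e) (auto simp: less_le)
  have "ennreal y \<le> ennreal (K * (d powr \<kappa> * y powr \<kappa>))"
    using x(1) y d K \<kappa> by (simp add: ennreal_mult[symmetric] epowr_ennreal powr_mult)
  then have "y \<le> K * (d powr \<kappa> * y powr \<kappa>)"
    using K by (subst (asm) ennreal_le_iff) auto
  then have "y / y powr \<kappa> \<le> K * d powr \<kappa>"
    using y by (simp add: field_simps)
  moreover have "y / y powr \<kappa> = y powr (1 - \<kappa>)"
    using y by (simp add: powr_diff)
  ultimately have "(y powr (1 - \<kappa>)) powr (1 / (1 - \<kappa>)) \<le> (K * d powr \<kappa>) powr (1 / (1 - \<kappa>))"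
    using \<kappa> by (intro powr_mono2) auto
  then have "y \<le> K powr (1 / (1 - \<kappa>)) * d powr (\<kappa> / (1 - \<kappa>))"
    using y \<kappa> by (simp add: powr_powr powr_mult)
  then show ?thesis
    using y d K \<kappa> by (simp add: ennreal_mult[symmetric] epowr_ennreal ennreal_leI)
qed

section \<open>Hoelder's inequality for two and for finitely many factors\<close>

text \<open>Young's inequality, rescaled. When \<open>A\<close> and \<open>B\<close> are the
  integrals of the two functions, the bracket on the right integrates to
  \<open>a + b = 1\<close>.\<close>

lemma powr_Young:
  fixes A B x y a b :: real
  assumes "0 < a" "0 < b" "a + b = 1" "0 < A" "0 < B" "0 \<le> x" "0 \<le> y"
  shows "x powr a * y powr b \<le> A powr a * B powr b * (a * (x / A) + b * (y / B))"
proof (cases "x = 0 \<or> y = 0")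
  case True
  have "0 \<le> A powr a * B powr b * (a * (x / A) + b * (y / B))"
    using assms by (intro mult_nonneg_nonneg add_nonneg_nonneg) auto
  with True show ?thesis by auto
next
  case False
  with assms have "(x / A) powr a * (y / B) powr b \<le> a * (x / A) + b * (y / B)"
    by (intro Youngs_inequality_0) auto
  then have "A powr a * B powr b * ((x / A) powr a * (y / B) powr b)
      \<le> A powr a * B powr b * (a * (x / A) + b * (y / B))"
    by (intro mult_left_mono) auto
  then show ?thesis using assms by (simp add: powr_divide)
qed

text \<open>The exponents are weights with sum \<open>1\<close> instead of conjugate exponents, so
  that the endpoints \<open>a = 0\<close> and \<open>b = 0\<close> are covered and several factors
  can be treated by induction. Once zero and infinite integrals are set apart, the rescaled Young
  inequality is integrated.\<close>

lemma nn_integral_Holder: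
  assumes [measurable]: "f \<in> borel_measurable M" "g \<in> borel_measurable M"
    and ab: "0 \<le> a" "0 \<le> b" "a + b = 1"
  shows "(\<integral>\<^sup>+x. epowr (f x) a * epowr (g x) b \<partial>M)
      \<le> epowr (\<integral>\<^sup>+x. f x \<partial>M) a * epowr (\<integral>\<^sup>+x. g x \<partial>M) b"
proof -
  consider "a = 0 \<or> b = 0" | "0 < a" "0 < b" "(\<integral>\<^sup>+x. f x \<partial>M) = 0 \<or> (\<integral>\<^sup>+x. g x \<partial>M) = 0"
    | "0 < a" "0 < b" "(\<integral>\<^sup>+x. f x \<partial>M) \<noteq> 0" "(\<integral>\<^sup>+x. g x \<partial>M) \<noteq> 0"
    using ab by linarith
  then show ?thesis
  proof cases
    case 1
    with ab show ?thesis by auto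
  next
    case 2
    then have "AE x in M. epowr (f x) a * epowr (g x) b = 0"
      by (auto simp: nn_integral_0_iff_AE)
    then have "(\<integral>\<^sup>+x. epowr (f x) a * epowr (g x) b \<partial>M) = 0"
      by (simp add: nn_integral_0_iff_AE)
    then show ?thesis by simp
  next
    case 3
    show ?thesis
    proof (cases "(\<integral>\<^sup>+x. f x \<partial>M) = top \<or> (\<integral>\<^sup>+x. g x \<partial>M) = top")
      case True
      with 3 have "epowr (\<integral>\<^sup>+x. f x \<partial>M) a * epowr (\<integral>\<^sup>+x. g x \<partial>M) b = top"
        by (auto simp: ennreal_top_mult ennreal_mult_top epowr_eq_0_iff)
      then show ?thesis by simp
    next
      case False
      with 3 obtain A B where A: "0 < A" "(\<integral>\<^sup>+x. f x \<partial>M) = ennreal A"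
        and B: "0 < B" "(\<integral>\<^sup>+x. g x \<partial>M) = ennreal B"
        by (metis ennreal_cases ennreal_0 less_le)
      let ?C = "ennreal (A powr a * B powr b)"
      have "epowr (f x) a * epowr (g x) b
          \<le> ?C * (ennreal (a / A) * f x + ennreal (b / B) * g x)" for x
      proof (cases "f x = top \<or> g x = top")
        case True
        \<comment> \<open>Positive coefficients make the right-hand side infinite as soon as one of
          the two functions is.\<close>
        have "0 < a / A" "0 < b / B" "0 < A powr a * B powr b" using A B 3 by auto
        with True show ?thesis
          by (auto simp: ennreal_mult_top ennreal_top_mult)
      next
        case False
        then obtain s t where st: "0 \<le> s" "0 \<le> t" "f x = ennreal s" "g x = ennreal t"
          by (metis ennreal_cases)
        have "s powr a * t powr b \<le> A powr a * B powr b * (a * (s / A) + b * (t / B))"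
          using 3 A B ab st by (intro powr_Young) auto
        with st A B 3 show ?thesis
          by (simp add: epowr_ennreal ennreal_mult[symmetric] ennreal_plus[symmetric]
              del: ennreal_plus)
      qed
      then have "(\<integral>\<^sup>+x. epowr (f x) a * epowr (g x) b \<partial>M)
          \<le> (\<integral>\<^sup>+x. ?C * (ennreal (a / A) * f x + ennreal (b / B) * g x) \<partial>M)"
        by (intro nn_integral_mono)
      also have "\<dots> = ?C * (ennreal (a / A) * ennreal A + ennreal (b / B) * ennreal B)"
        by (simp add: nn_integral_cmult nn_integral_add A B)
      also have "ennreal (a / A) * ennreal A + ennreal (b / B) * ennreal B = 1"
        using A B 3 ab by (simp add: ennreal_mult[symmetric] ennreal_plus[symmetric] del: ennreal_plus)
      finally show ?thesis
        using A B 3 by (simp add: epowr_ennreal ennreal_mult)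
    qed
  qed
qed

lemma nn_integral_Holder_prod:
  assumes "finite I" "\<And>i. i \<in> I \<Longrightarrow> f i \<in> borel_measurable M"
    "\<And>i. i \<in> I \<Longrightarrow> 0 \<le> w i" "(\<Sum>i\<in>I. w i) = 1"
  shows "(\<integral>\<^sup>+x. (\<Prod>i\<in>I. epowr (f i x) (w i)) \<partial>M) \<le> (\<Prod>i\<in>I. epowr (\<integral>\<^sup>+x. f i x \<partial>M) (w i))"
  using assms
proof (induction I arbitrary: w rule: finite_induct)
  case empty
  then show ?case by simp
next
  case (insert j I)
  have [measurable]: "f j \<in> borel_measurable M" "\<And>i. i \<in> I \<Longrightarrow> f i \<in> borel_measurable M"
    using insert.prems by auto
  let ?W = "\<Sum>i\<in>I. w i"
  have W: "w j + ?W = 1" "0 \<le> w j" "0 \<le> ?W" "\<And>i. i \<in> I \<Longrightarrow> 0 \<le> w i"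
    using insert by (auto intro!: sum_nonneg)
  show ?case
  proof (cases "?W = 0")
    case True
    then have "\<And>i. i \<in> I \<Longrightarrow> w i = 0" using W insert.hyps
      by (simp add: sum_nonneg_eq_0_iff)
    with True W insert.hyps show ?thesis by simp
  next
    case False
    \<comment> \<open>The remaining weights are rescaled to have sum \<open>1\<close>, as the
      induction hypothesis demands; the outer exponent \<open>?W\<close> undoes the
      rescaling.\<close>
    let ?v = "\<lambda>i. w i / ?W"
    have eq: "epowr (\<Prod>i\<in>I. epowr (h i) (?v i)) ?W = (\<Prod>i\<in>I. epowr (h i) (w i))" for h
      using False W by (simp add: epowr_prod epowr_epowr)
    have "(\<integral>\<^sup>+x. (\<Prod>i\<in>insert j I. epowr (f i x) (w i)) \<partial>M)
        = (\<integral>\<^sup>+x. epowr (f j x) (w j) * epowr (\<Prod>i\<in>I. epowr (f i x) (?v i)) ?W \<partial>M)"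
      using insert.hyps by (simp add: eq)
    also have "\<dots> \<le> epowr (\<integral>\<^sup>+x. f j x \<partial>M) (w j)
        * epowr (\<integral>\<^sup>+x. (\<Prod>i\<in>I. epowr (f i x) (?v i)) \<partial>M) ?W"
      using W by (intro nn_integral_Holder) auto
    also have "(\<integral>\<^sup>+x. (\<Prod>i\<in>I. epowr (f i x) (?v i)) \<partial>M)
        \<le> (\<Prod>i\<in>I. epowr (\<integral>\<^sup>+x. f i x \<partial>M) (?v i))"
      using W False by (intro insert.IH) (auto simp: sum_divide_distrib[symmetric])
    finally show ?thesis
      using insert.hyps W by (simp add: eq epowr_mono mult_left_mono)
  qed
qed

section \<open>The Gagliardo inequality\<close>

text \<open>The exponent \<open>p\<close> is left free to make induction over the coordinates work;
  at \<open>p = 1 / (card I - 1)\<close> the factor \<open>f\<close> disappears and only line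
  integrals remain. When one further coordinate \<open>i\<close> is integrated out, the line
  integral in direction \<open>i\<close> is constant and comes out, Hoelder's inequality handles the
  other factors, and the result is the same expression for the marginal \<open>F\<close> in one
  dimension fewer.\<close>

lemma (in product_sigma_finite) grid_lines_inequality:
  assumes "finite I" and "f \<in> borel_measurable (Pi\<^sub>M I M)"
    and p: "0 \<le> p" and "(real (card I) - 1) * p \<le> 1"
  shows "(\<integral>\<^sup>+x. epowr (f x) (1 - (real (card I) - 1) * p)
        * (\<Prod>i\<in>I. epowr (\<integral>\<^sup>+t. f (x(i := t)) \<partial>M i) p) \<partial>Pi\<^sub>M I M)
      \<le> epowr (\<integral>\<^sup>+x. f x \<partial>Pi\<^sub>M I M) (1 + p)"
  using assms
proof (induction I arbitrary: f rule: finite_induct)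
  case empty
  then show ?case by (simp add: nn_integral_empty)
next
  case (insert i I)
  note [measurable] = insert.prems(1)
  have upd: "(\<lambda>z. f ((fst z)(i := snd z))) \<in> borel_measurable (Pi\<^sub>M I M \<Otimes>\<^sub>M M i)"
    by (rule measurable_compose[OF _ insert.prems(1)], rule measurable_fun_upd[where J=I]) auto
  define k where "k = real (card I)"
  have k: "0 \<le> k" "k * p \<le> 1" and card: "real (card (insert i I)) - 1 = k"
    using insert by (auto simp: k_def)
  define F where "F x = (\<integral>\<^sup>+t. f (x(i := t)) \<partial>M i)" for x
  have F [measurable]: "F \<in> borel_measurable (Pi\<^sub>M I M)"
    unfolding F_def using sigma_finite_measure.borel_measurable_nn_integral[OF sigma_finite_measures, of "\<lambda>x t. f (x(i := t))"] upd
    by (simp add: case_prod_unfold)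
  have lines [measurable]: "(\<lambda>x. \<integral>\<^sup>+t. f (x(j := t)) \<partial>M j) \<in> borel_measurable (Pi\<^sub>M (insert i I) M)"
    if "j \<in> insert i I" for j
  proof -
    have "(\<lambda>z. f ((fst z)(j := snd z))) \<in> borel_measurable (Pi\<^sub>M (insert i I) M \<Otimes>\<^sub>M M j)"
      using that by (intro measurable_compose[OF _ insert.prems(1)]
          measurable_fun_upd[where J="insert i I"]) auto
    then show ?thesis
      using sigma_finite_measure.borel_measurable_nn_integral[OF sigma_finite_measures, of "\<lambda>x t. f (x(j := t))"]
      by (simp add: case_prod_unfold)
  qed
  have inner: "(\<integral>\<^sup>+t. epowr (f (x(i := t))) (1 - k * p)
        * (\<Prod>j\<in>insert i I. epowr (\<integral>\<^sup>+r. f (x(i := t, j := r)) \<partial>M j) p) \<partial>M i)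
      \<le> epowr (F x) (1 - (k - 1) * p) * (\<Prod>j\<in>I. epowr (\<integral>\<^sup>+r. F (x(j := r)) \<partial>M j) p)"
    if x: "x \<in> space (Pi\<^sub>M I M)" for x
  proof -
    have f_t [measurable]: "(\<lambda>t. f (x(i := t))) \<in> borel_measurable (M i)"
      by (rule measurable_compose[OF _ insert.prems(1)], rule measurable_fun_upd[where J=I])
         (use x in auto)
    have f_tr: "(\<lambda>z. f (x(i := fst z, j := snd z))) \<in> borel_measurable (M i \<Otimes>\<^sub>M M j)"
      if "j \<in> I" for j
      by (rule measurable_compose[OF _ insert.prems(1)],
          rule measurable_fun_upd[where J="insert i I"], use that in blast,
          rule measurable_fun_upd[where J=I]) (use x in auto)
    \<comment> \<open>The factor for \<open>j = i\<close> is \<open>f\<close> with the leftover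
      exponent, all others are line integrals; the weights add up to
      \<open>1 - k * p + k * p = 1\<close>.\<close>
    define h where "h j t = (if j = i then f (x(i := t)) else \<integral>\<^sup>+r. f (x(i := t, j := r)) \<partial>M j)" for j t
    define w where "w j = (if j = i then 1 - k * p else p)" for j
    have h_meas: "h j \<in> borel_measurable (M i)" if "j \<in> insert i I" for j
    proof (cases "j = i")
      case True
      have "h j = (\<lambda>t. f (x(i := t)))" by (simp add: h_def fun_eq_iff True)
      then show ?thesis by simp
    next
      case False
      then have "j \<in> I" using that by simp
      have "h j = (\<lambda>t. \<integral>\<^sup>+r. f (x(i := t, j := r)) \<partial>M j)"
        using False by (auto simp: h_def fun_eq_iff)
      then show ?thesis
        using sigma_finite_measure.borel_measurable_nn_integral[OF sigma_finite_measures, of "\<lambda>t r. f (x(i := t, j := r))"] f_tr[OF \<open>j \<in> I\<close>]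
        by (simp add: case_prod_unfold)
    qed
    have "(\<Sum>j\<in>I. w j) = (\<Sum>j\<in>I. p)"
      using insert.hyps by (intro sum.cong) (auto simp: w_def)
    then have "(\<Sum>j\<in>insert i I. w j) = 1"
      using insert.hyps by (simp add: w_def k_def)
    then have Hol: "(\<integral>\<^sup>+t. (\<Prod>j\<in>insert i I. epowr (h j t) (w j)) \<partial>M i)
        \<le> (\<Prod>j\<in>insert i I. epowr (\<integral>\<^sup>+t. h j t \<partial>M i) (w j))"
      using insert.hyps h_meas k p by (intro nn_integral_Holder_prod) (auto simp: w_def)
    \<comment> \<open>Tonelli's theorem turns integrated line integrals of \<open>f\<close> into
      line integrals of the marginal \<open>F\<close>.\<close>
    have swap: "(\<integral>\<^sup>+t. h j t \<partial>M i) = (\<integral>\<^sup>+r. F (x(j := r)) \<partial>M j)" if "j \<in> I" for j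
    proof -
      have "j \<noteq> i" using that insert.hyps by auto
      interpret P: pair_sigma_finite "M i" "M j"
        by (simp add: pair_sigma_finite_def sigma_finite_measures)
      have "(\<integral>\<^sup>+t. h j t \<partial>M i) = (\<integral>\<^sup>+t. (\<integral>\<^sup>+r. f (x(i := t, j := r)) \<partial>M j) \<partial>M i)"
        using \<open>j \<noteq> i\<close> by (simp add: h_def)
      also have "\<dots> = (\<integral>\<^sup>+r. (\<integral>\<^sup>+t. f (x(i := t, j := r)) \<partial>M i) \<partial>M j)"
        using P.Fubini'[of "\<lambda>t r. f (x(i := t, j := r))"] f_tr[OF that]
        by (simp add: case_prod_unfold)
      finally show ?thesis
        using \<open>j \<noteq> i\<close> by (simp add: F_def fun_upd_twist)
    qed
    have prod_I: "(\<Prod>j\<in>I. epowr (h j t) (w j)) = (\<Prod>j\<in>I. epowr (\<integral>\<^sup>+r. f (x(i := t, j := r)) \<partial>M j) p)" for t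
      using insert.hyps by (intro prod.cong) (auto simp: h_def w_def)
    \<comment> \<open>In direction \<open>i\<close> the update by \<open>r\<close> overwrites
      \<open>t\<close>, so this factor equals \<open>epowr (F x) p\<close> for every
      \<open>t\<close>.\<close>
    have "(\<integral>\<^sup>+t. epowr (f (x(i := t))) (1 - k * p)
        * (\<Prod>j\<in>insert i I. epowr (\<integral>\<^sup>+r. f (x(i := t, j := r)) \<partial>M j) p) \<partial>M i)
      = (\<integral>\<^sup>+t. epowr (F x) p * (\<Prod>j\<in>insert i I. epowr (h j t) (w j)) \<partial>M i)"
      using insert.hyps prod_I
      by (intro nn_integral_cong) (simp add: F_def h_def w_def mult_ac)
    also have "\<dots> = epowr (F x) p * (\<integral>\<^sup>+t. (\<Prod>j\<in>insert i I. epowr (h j t) (w j)) \<partial>M i)"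
      using h_meas by (intro nn_integral_cmult borel_measurable_prod borel_measurable_epowr) auto
    also have "\<dots> \<le> epowr (F x) p * (\<Prod>j\<in>insert i I. epowr (\<integral>\<^sup>+t. h j t \<partial>M i) (w j))"
      by (intro mult_left_mono Hol) auto
    also have "(\<Prod>j\<in>insert i I. epowr (\<integral>\<^sup>+t. h j t \<partial>M i) (w j))
        = epowr (F x) (1 - k * p) * (\<Prod>j\<in>I. epowr (\<integral>\<^sup>+r. F (x(j := r)) \<partial>M j) p)"
    proof -
      have "(\<Prod>j\<in>I. epowr (\<integral>\<^sup>+t. h j t \<partial>M i) (w j)) = (\<Prod>j\<in>I. epowr (\<integral>\<^sup>+r. F (x(j := r)) \<partial>M j) p)"
        using insert.hyps by (intro prod.cong) (auto simp: swap w_def)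
      then show ?thesis
        using insert.hyps by (simp add: h_def w_def F_def)
    qed
    also have "epowr (F x) p * (epowr (F x) (1 - k * p) * (\<Prod>j\<in>I. epowr (\<integral>\<^sup>+r. F (x(j := r)) \<partial>M j) p))
        = epowr (F x) (1 - (k - 1) * p) * (\<Prod>j\<in>I. epowr (\<integral>\<^sup>+r. F (x(j := r)) \<partial>M j) p)"
      using epowr_add[of p "1 - k * p" "F x"] k p by (simp add: algebra_simps)
    finally show ?thesis .
  qed
  have "(\<integral>\<^sup>+x. epowr (f x) (1 - k * p)
        * (\<Prod>j\<in>insert i I. epowr (\<integral>\<^sup>+t. f (x(j := t)) \<partial>M j) p) \<partial>Pi\<^sub>M (insert i I) M)
     = (\<integral>\<^sup>+x. (\<integral>\<^sup>+t. epowr (f (x(i := t))) (1 - k * p)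
        * (\<Prod>j\<in>insert i I. epowr (\<integral>\<^sup>+r. f (x(i := t, j := r)) \<partial>M j) p) \<partial>M i) \<partial>Pi\<^sub>M I M)"
    using insert.hyps by (subst product_nn_integral_insert) measurable
  also have "\<dots> \<le> (\<integral>\<^sup>+x. epowr (F x) (1 - (k - 1) * p)
      * (\<Prod>j\<in>I. epowr (\<integral>\<^sup>+r. F (x(j := r)) \<partial>M j) p) \<partial>Pi\<^sub>M I M)"
    by (intro nn_integral_mono inner)
  also have "\<dots> \<le> epowr (\<integral>\<^sup>+x. F x \<partial>Pi\<^sub>M I M) (1 + p)"
  proof -
    have "(k - 1) * p \<le> 1" using k p by (simp add: algebra_simps)
    then show ?thesis unfolding k_def by (rule insert.IH[OF F p])
  qed
  also have "(\<integral>\<^sup>+x. F x \<partial>Pi\<^sub>M I M) = (\<integral>\<^sup>+x. f x \<partial>Pi\<^sub>M (insert i I) M)"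
    using insert.hyps insert.prems by (simp add: product_nn_integral_insert F_def)
  finally show ?case by (simp only: card)
qed

text \<open>Only a bound along coordinate lines is asked of \<open>v\<close>, and no continuity. The
  result therefore applies to functions on the half-space extended by \<open>0\<close>, which may
  jump at the boundary. The bounds in all directions are raised to the power \<open>p\<close>,
  multiplied, and integrated by the grid-lines inequality.\<close>

lemma Gagliardo_inequality:
  fixes v G :: "'a::euclidean_space \<Rightarrow> ennreal"
  assumes [measurable]: "v \<in> borel_measurable borel" "G \<in> borel_measurable borel"
    and dim: "DIM('a) \<ge> 2"
    and lines: "\<And>x b. b \<in> Basis \<Longrightarrow> v x \<le> (\<integral>\<^sup>+r. G (x + r *\<^sub>R b) \<partial>lborel)"
  defines "q \<equiv> real DIM('a) / (real DIM('a) - 1)"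
  shows "(\<integral>\<^sup>+x. epowr (v x) q \<partial>lborel) \<le> epowr (\<integral>\<^sup>+x. G x \<partial>lborel) q"
proof -
  \<comment> \<open>At this exponent the product of the line bounds carries the power
    \<open>q = DIM('a) * p\<close> of \<open>v\<close>, and the free factor of \<open>G\<close> in
    the grid-lines inequality has exponent \<open>0\<close>.\<close>
  define p where "p = 1 / (real DIM('a) - 1)"
  have p: "0 < p" "(real DIM('a) - 1) * p = 1" and q: "q = 1 + p" "q = real DIM('a) * p"
    using dim by (auto simp: p_def q_def field_simps)
  let ?P = "\<Pi>\<^sub>M b\<in>(Basis :: 'a set). (lborel :: real measure)"
  define E where "E f = (\<Sum>b\<in>Basis. f b *\<^sub>R b :: 'a)" for f
  have E [measurable]: "E \<in> borel_measurable ?P"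
    unfolding E_def by measurable
  interpret product_sigma_finite "\<lambda>_::'a. lborel :: real measure"
    by standard
  have lborel: "lborel = distr ?P borel E"
    unfolding E_def[abs_def] by (rule lborel_eq)
  have upd: "E (x(b := t)) = E x + (t - x b) *\<^sub>R b" if "b \<in> Basis" for x b t
  proof -
    have "E (x(b := t)) = (\<Sum>c\<in>Basis. x c *\<^sub>R c + (if c = b then (t - x b) *\<^sub>R b else 0))"
      unfolding E_def by (intro sum.cong) (auto simp: algebra_simps)
    also have "\<dots> = E x + (t - x b) *\<^sub>R b"
      using that by (simp add: sum.distrib E_def)
    finally show ?thesis .
  qed
  have line: "v (E x) \<le> (\<integral>\<^sup>+t. G (E (x(b := t))) \<partial>lborel)" if "b \<in> Basis" for x b
  proof -
    have "v (E x) \<le> (\<integral>\<^sup>+r. G (E x + r *\<^sub>R b) \<partial>lborel)" by (rule lines[OF that])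
    also have "\<dots> = (\<integral>\<^sup>+t. G (E x + (- x b + 1 * t) *\<^sub>R b) \<partial>lborel)"
      by (subst nn_integral_real_affine[where c=1 and t="- x b"]) auto
    finally show ?thesis by (simp add: upd that)
  qed
  have "(\<integral>\<^sup>+x. epowr (v x) q \<partial>lborel) = (\<integral>\<^sup>+x. epowr (v (E x)) q \<partial>?P)"
    unfolding lborel by (subst nn_integral_distr) auto
  also have "\<dots> \<le> (\<integral>\<^sup>+x. epowr (G (E x)) (1 - (real DIM('a) - 1) * p)
      * (\<Prod>b\<in>Basis. epowr (\<integral>\<^sup>+t. G (E (x(b := t))) \<partial>lborel) p) \<partial>?P)"
  proof (intro nn_integral_mono)
    fix x
    have "epowr (v (E x)) q = (\<Prod>b\<in>(Basis :: 'a set). epowr (v (E x)) p)"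
      using p q by (simp add: epowr_power)
    also have "\<dots> \<le> (\<Prod>b\<in>Basis. epowr (\<integral>\<^sup>+t. G (E (x(b := t))) \<partial>lborel) p)"
      using p by (intro prod_mono_ennreal epowr_mono line) auto
    finally show "epowr (v (E x)) q \<le> epowr (G (E x)) (1 - (real DIM('a) - 1) * p)
      * (\<Prod>b\<in>Basis. epowr (\<integral>\<^sup>+t. G (E (x(b := t))) \<partial>lborel) p)"
      by (simp add: p)
  qed
  also have "\<dots> \<le> epowr (\<integral>\<^sup>+x. G (E x) \<partial>?P) (1 + p)"
    using p by (intro grid_lines_inequality) auto
  also have "(\<integral>\<^sup>+x. G (E x) \<partial>?P) = (\<integral>\<^sup>+x. G x \<partial>lborel)"
    unfolding lborel by (subst nn_integral_distr) auto
  finally show ?thesis by (simp add: q)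
qed

section \<open>Functions of class \<open>C\<^sup>1\<close> with compact support\<close>

text \<open>The gradient is carried along as an explicit continuous function on the whole space.
  This gives measurability and boundedness directly, while the definite description
  \<open>grad\<close> has to be evaluated only on the half-space.\<close>

definition C1_compact :: "('a::euclidean_space \<Rightarrow> real) \<Rightarrow> ('a \<Rightarrow> 'a) \<Rightarrow> bool" where
  "C1_compact u g \<longleftrightarrow> (\<forall>x. GDERIV u x :> g x) \<and> continuous_on UNIV g \<and>
     (\<exists>R. \<forall>x. norm x > R \<longrightarrow> u x = 0)"

lemma C1_compact_GDERIV: "C1_compact u g \<Longrightarrow> GDERIV u x :> g x"
  by (simp add: C1_compact_def)

lemma C1_compact_continuous:
  assumes "C1_compact u g"
  shows "continuous_on UNIV u" "continuous_on UNIV g"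
proof -
  have "isCont u x" for x
    using assms unfolding C1_compact_def gderiv_def by (blast intro: has_derivative_continuous)
  then show "continuous_on UNIV u" by (simp add: continuous_at_imp_continuous_on)
  show "continuous_on UNIV g" using assms by (simp add: C1_compact_def)
qed

lemma C1_compact_borel:
  assumes "C1_compact u g"
  shows "u \<in> borel_measurable borel" "g \<in> borel_measurable borel"
  using C1_compact_continuous[OF assms] by (auto intro: borel_measurable_continuous_onI)

lemma GDERIV_unique:
  assumes "GDERIV f x :> D" "GDERIV f x :> D'"
  shows "D = D'"
proof -
  have "(\<lambda>h. inner h D) = (\<lambda>h. inner h D')"
    using assms unfolding gderiv_def by (rule has_derivative_unique)
  then have "inner h (D - D') = 0" for h
    by (metis inner_diff_right right_minus_eq)
  from this[of "D - D'"] show ?thesis by simp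
qed

lemma GDERIV_transform:
  assumes "GDERIV f x :> D" "open S" "x \<in> S" "\<And>y. y \<in> S \<Longrightarrow> f y = f' y"
  shows "GDERIV f' x :> D"
  using assms unfolding gderiv_def by (rule has_derivative_transform_within_open)

text \<open>Outside a large ball \<open>u\<close> vanishes on an open set, hence so does its
  gradient.\<close>

lemma C1_compact_support:
  assumes "C1_compact u g"
  shows "\<exists>R>0. \<forall>x. norm x > R \<longrightarrow> u x = 0 \<and> g x = 0"
proof -
  from assms obtain R where R: "\<And>x. norm x > R \<Longrightarrow> u x = 0"
    by (auto simp: C1_compact_def)
  have g: "g x = 0" if "norm x > R" for x
  proof -
    have "open {x. norm x > R}" by (intro open_Collect_less continuous_intros)
    then have "GDERIV u x :> 0"
      using that R by (intro GDERIV_transform[OF GDERIV_const[of 0], of "{x. norm x > R}"]) auto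
    with C1_compact_GDERIV[OF assms] show ?thesis by (blast intro: GDERIV_unique)
  qed
  show ?thesis
    using R g by (intro exI[of _ "max R 1"]) auto
qed

lemma C1_compact_bounded:
  assumes "C1_compact u g"
  shows "\<exists>B>0. \<forall>x. \<bar>u x\<bar> \<le> B \<and> norm (g x) \<le> B"
proof -
  obtain R where R: "\<forall>x. norm x > R \<longrightarrow> u x = 0 \<and> g x = 0"
    using C1_compact_support[OF assms] by blast
  have "bounded (u ` cball 0 R)"
    by (rule compact_imp_bounded, rule compact_continuous_image)
       (rule continuous_on_subset[OF C1_compact_continuous(1)[OF assms]], simp_all)
  then obtain A where A: "\<forall>x\<in>cball 0 R. norm (u x) \<le> A"
    unfolding bounded_iff by (metis imageI)
  have "bounded (g ` cball 0 R)"
    by (rule compact_imp_bounded, rule compact_continuous_image)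
       (rule continuous_on_subset[OF C1_compact_continuous(2)[OF assms]], simp_all)
  then obtain B where B: "\<forall>x\<in>cball 0 R. norm (g x) \<le> B"
    unfolding bounded_iff by (metis imageI)
  have "\<bar>u x\<bar> \<le> max 1 (max A B) \<and> norm (g x) \<le> max 1 (max A B)" for x
  proof (cases "norm x > R")
    case True
    with R show ?thesis by (auto simp: max_def)
  next
    case False
    then have "x \<in> cball 0 R" by simp
    with A B have "norm (u x) \<le> A" "norm (g x) \<le> B" by blast+
    then show ?thesis by (simp add: le_max_iff_disj)
  qed
  then show ?thesis by (intro exI[of _ "max 1 (max A B)"]) simp
qed

text \<open>Only \<open>r = 0\<close> is delicate: there the difference quotient has absolute value
  \<open>\<bar>h\<bar> powr (s - 1)\<close>, which tends to \<open>0\<close> because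
  \<open>s > 1\<close>.\<close>

lemma has_real_derivative_abs_powr:
  fixes s :: real
  assumes "1 < s"
  shows "((\<lambda>r. \<bar>r\<bar> powr s) has_real_derivative s * \<bar>r\<bar> powr (s - 1) * sgn r) (at r)"
proof -
  consider "r > 0" | "r < 0" | "r = 0" by linarith
  then show ?thesis
  proof cases
    case 1
    have "((\<lambda>r. r powr s) has_real_derivative s * r powr (s - 1)) (at r)"
      using 1 by (rule has_real_derivative_powr)
    then have "((\<lambda>r. \<bar>r\<bar> powr s) has_real_derivative s * r powr (s - 1)) (at r)"
      by (rule has_field_derivative_transform_within_open[of _ _ _ "{0<..}"]) (use 1 in auto)
    with 1 show ?thesis by simp
  next
    case 2
    have "((\<lambda>r. (- r) powr s) has_real_derivative s * (- r) powr (s - 1) * (- 1)) (at r)"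
      using 2 by (auto intro!: derivative_eq_intros simp: powr_diff)
    then have "((\<lambda>r. \<bar>r\<bar> powr s) has_real_derivative s * (- r) powr (s - 1) * (- 1)) (at r)"
      by (rule has_field_derivative_transform_within_open[of _ _ _ "{..<0}"]) (use 2 in auto)
    with 2 show ?thesis by simp
  next
    case 3
    have "((\<lambda>h. \<bar>h\<bar> powr (s - 1)) \<longlongrightarrow> 0) (at (0::real))"
      using assms by (auto intro!: tendsto_eq_intros)
    then have "((\<lambda>h. \<bar>h\<bar> powr s / h) \<longlongrightarrow> 0) (at (0::real))"
      by (rule tendsto_rabs_zero_cancel[OF Lim_transform_eventually])
         (auto simp: eventually_at_filter powr_diff abs_mult)
    with 3 show ?thesis
      by (simp add: DERIV_def)
  qed
qed

text \<open>This is the fundamental theorem of calculus on the segment from \<open>x\<close> to a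
  point beyond the support. Integrating forwards only matters later: rays in coordinate directions
  stay in the half-space, and \<open>t\<close> does not decrease along them.\<close>

lemma abs_powr_le_line_integral:
  assumes u: "C1_compact u g" and s: "1 < s" and b: "norm b = 1"
  shows "ennreal (\<bar>u x\<bar> powr s)
    \<le> (\<integral>\<^sup>+r. ennreal (indicator {0..} r * (s * \<bar>u (x + r *\<^sub>R b)\<bar> powr (s - 1) * norm (g (x + r *\<^sub>R b)))) \<partial>lborel)"
proof -
  obtain R where R: "0 < R" "\<forall>x. norm x > R \<longrightarrow> u x = 0 \<and> g x = 0"
    using C1_compact_support[OF u] by blast
  \<comment> \<open>At this parameter the norm of \<open>x + T *\<^sub>R b\<close> is at least
    \<open>T - norm x = R + 1\<close>, so \<open>u\<close> vanishes there.\<close>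
  define T where "T = R + norm x + 1"
  have "norm (x + T *\<^sub>R b) \<ge> norm (T *\<^sub>R b) - norm x"
    by (metis add.commute norm_diff_ineq)
  then have T: "0 \<le> T" "u (x + T *\<^sub>R b) = 0"
    using R b by (auto simp: T_def)
  define h where "h r = s * \<bar>u (x + r *\<^sub>R b)\<bar> powr (s - 1) * norm (g (x + r *\<^sub>R b))" for r
  define d where "d r = s * \<bar>u (x + r *\<^sub>R b)\<bar> powr (s - 1) * sgn (u (x + r *\<^sub>R b)) * inner b (g (x + r *\<^sub>R b))" for r
  have der: "((\<lambda>r. \<bar>u (x + r *\<^sub>R b)\<bar> powr s) has_real_derivative d r) (at r)" for r
  proof -
    have "((\<lambda>r. x + r *\<^sub>R b) has_derivative (\<lambda>h. h *\<^sub>R b)) (at r)"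
      by (auto intro!: derivative_eq_intros)
    moreover have "(u has_derivative (\<lambda>h. inner h (g (x + r *\<^sub>R b)))) (at (x + r *\<^sub>R b))"
      using C1_compact_GDERIV[OF u] by (simp add: gderiv_def)
    ultimately have "((\<lambda>r. u (x + r *\<^sub>R b)) has_derivative (\<lambda>h. inner (h *\<^sub>R b) (g (x + r *\<^sub>R b)))) (at r)"
      by (rule has_derivative_compose)
    then have "((\<lambda>r. u (x + r *\<^sub>R b)) has_real_derivative inner b (g (x + r *\<^sub>R b))) (at r)"
      by (simp add: has_field_derivative_def mult.commute[of _ "inner b _"])
    from DERIV_chain2[OF has_real_derivative_abs_powr[OF s] this] show ?thesis
      by (simp add: d_def)
  qed
  have "((\<lambda>r. - d r) has_integral - (\<bar>u (x + T *\<^sub>R b)\<bar> powr s - \<bar>u (x + 0 *\<^sub>R b)\<bar> powr s)) {0..T}"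
    using T by (intro has_integral_neg fundamental_theorem_of_calculus)
      (auto simp: has_real_derivative_iff_has_vector_derivative[symmetric] 
        intro: has_field_derivative_at_within der)
  then have I: "((\<lambda>r. - d r) has_integral \<bar>u x\<bar> powr s) {0..T}"
    using T s by simp
  have "continuous_on {0..T} h"
    unfolding h_def using s
    by (intro continuous_intros continuous_on_compose2[OF C1_compact_continuous(1)[OF u]]
        continuous_on_compose2[OF C1_compact_continuous(2)[OF u]] continuous_on_powr') auto
  then obtain H where H: "(h has_integral H) {0..T}"
    using integrable_continuous_interval by blast
  have "- d r \<le> h r" for r
  proof -
    have "\<bar>d r\<bar> = s * \<bar>u (x + r *\<^sub>R b)\<bar> powr (s - 1) * \<bar>sgn (u (x + r *\<^sub>R b))\<bar> * \<bar>inner b (g (x + r *\<^sub>R b))\<bar>"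
      using s by (simp add: d_def abs_mult)
    also have "\<dots> \<le> s * \<bar>u (x + r *\<^sub>R b)\<bar> powr (s - 1) * 1 * norm (g (x + r *\<^sub>R b))"
      using s b Cauchy_Schwarz_ineq2[of b "g (x + r *\<^sub>R b)"]
      by (intro mult_mono mult_left_mono) (auto simp: sgn_if)
    finally show ?thesis by (simp add: h_def)
  qed
  then have "\<bar>u x\<bar> powr s \<le> H"
    using has_integral_le[OF I H] by simp
  then have "ennreal (\<bar>u x\<bar> powr s) \<le> ennreal H" by (rule ennreal_leI)
  also have "ennreal H = (\<integral>\<^sup>+r. ennreal (indicator {0..T} r * h r) \<partial>lborel)"
    using nn_integral_has_integral_lebesgue[OF _ H] s by (simp add: h_def)
  also have "\<dots> \<le> (\<integral>\<^sup>+r. ennreal (indicator {0..} r * h r) \<partial>lborel)"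
    using s by (intro nn_integral_mono ennreal_leI mult_right_mono) (auto simp: h_def split: split_indicator)
  finally show ?thesis by (simp add: h_def)
qed

section \<open>Weighted inequalities on the half-space\<close>

lemma half_space_open: "open half_space"
  unfolding half_space_def by (intro open_Collect_less continuous_intros)

lemma half_space_borel [measurable]: "half_space \<in> sets borel"
  by (rule borel_open[OF half_space_open])

lemma borel_measurable_snd [measurable (raw)]:
  fixes f :: "'c \<Rightarrow> 'a::second_countable_topology \<times> 'b::second_countable_topology"
  assumes "f \<in> borel_measurable M"
  shows "(\<lambda>x. snd (f x)) \<in> borel_measurable M"
  using assms by (simp add: borel_prod[symmetric])

text \<open>A density is used rather than a restricted space: the measurable sets stay the Borel
  sets of the whole space, so measurability never refers to the half-space.\<close>

abbreviation half_lborel :: "((real ^ 'n) \<times> real) measure" where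
  "half_lborel \<equiv> density lborel (indicator half_space)"

lemma nn_integral_half_lborel:
  assumes [measurable]: "f \<in> borel_measurable borel"
  shows "(\<integral>\<^sup>+x. f x \<partial>half_lborel) = (\<integral>\<^sup>+x\<in>half_space. f x \<partial>lborel)"
  by (subst nn_integral_density) (auto simp: mult.commute)

text \<open>Both exponents of the integrand are affine in \<open>\<theta>\<close>, so the integrand
  factors into powers \<open>1 - \<theta>\<close> and \<open>\<theta>\<close> of the endpoint
  integrands, and Hoelder's inequality applies.\<close>

lemma weighted_interpolation:
  fixes u :: "(real ^ 'n) \<times> real \<Rightarrow> real"
  assumes [measurable]: "u \<in> borel_measurable borel" and th: "0 \<le> \<theta>" "\<theta> \<le> 1"
    and b: "b = (1 - \<theta>) * b0 + \<theta> * b1" and q: "q = (1 - \<theta>) * q0 + \<theta> * q1"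
  shows "(\<integral>\<^sup>+x. ennreal (snd x powr b * \<bar>u x\<bar> powr q) \<partial>half_lborel)
    \<le> epowr (\<integral>\<^sup>+x. ennreal (snd x powr b0 * \<bar>u x\<bar> powr q0) \<partial>half_lborel) (1 - \<theta>)
      * epowr (\<integral>\<^sup>+x. ennreal (snd x powr b1 * \<bar>u x\<bar> powr q1) \<partial>half_lborel) \<theta>"
proof (cases "\<theta> = 0 \<or> \<theta> = 1")
  \<comment> \<open>The endpoints are treated directly, since \<open>powr\<close> and
    \<open>epowr\<close> disagree about \<open>0\<close> to the power \<open>0\<close>.\<close>
  case True
  with b q show ?thesis by auto
next
  case False
  have "(\<integral>\<^sup>+x. ennreal (snd x powr b * \<bar>u x\<bar> powr q) \<partial>half_lborel)
      = (\<integral>\<^sup>+x. epowr (ennreal (snd x powr b0 * \<bar>u x\<bar> powr q0)) (1 - \<theta>)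
      * epowr (ennreal (snd x powr b1 * \<bar>u x\<bar> powr q1)) \<theta> \<partial>half_lborel)"
  proof (intro nn_integral_cong)
    fix x :: "(real ^ 'n) \<times> real"
    have "snd x powr b * \<bar>u x\<bar> powr q
        = (snd x powr ((1 - \<theta>) * b0) * snd x powr (\<theta> * b1))
        * (\<bar>u x\<bar> powr ((1 - \<theta>) * q0) * \<bar>u x\<bar> powr (\<theta> * q1))"
      by (simp only: b q powr_add)
    also have "\<dots> = (snd x powr b0 * \<bar>u x\<bar> powr q0) powr (1 - \<theta>) * (snd x powr b1 * \<bar>u x\<bar> powr q1) powr \<theta>"
      by (simp add: powr_mult powr_powr mult.commute mult.left_commute)
    finally show "ennreal (snd x powr b * \<bar>u x\<bar> powr q)
        = epowr (ennreal (snd x powr b0 * \<bar>u x\<bar> powr q0)) (1 - \<theta>)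
        * epowr (ennreal (snd x powr b1 * \<bar>u x\<bar> powr q1)) \<theta>"
      using False by (simp add: epowr_ennreal ennreal_mult[symmetric])
  qed
  also have "\<dots> \<le> epowr (\<integral>\<^sup>+x. ennreal (snd x powr b0 * \<bar>u x\<bar> powr q0) \<partial>half_lborel) (1 - \<theta>)
      * epowr (\<integral>\<^sup>+x. ennreal (snd x powr b1 * \<bar>u x\<bar> powr q1) \<partial>half_lborel) \<theta>"
    using th by (intro nn_integral_Holder) auto
  finally show ?thesis .
qed

text \<open>The exponents are halved so that the mixed integrals produced by the Hardy and Sobolev
  inequalities split into the energy and a weighted power integral.\<close>

lemma weighted_Cauchy_Schwarz:
  fixes u :: "(real ^ 'n) \<times> real \<Rightarrow> real" and g :: "(real ^ 'n) \<times> real \<Rightarrow> (real ^ 'n) \<times> real"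
  assumes [measurable]: "u \<in> borel_measurable borel" "g \<in> borel_measurable borel"
  shows "(\<integral>\<^sup>+x. ennreal (snd x powr ((\<alpha> + b) / 2) * \<bar>u x\<bar> powr (q / 2) * norm (g x)) \<partial>half_lborel)
    \<le> epowr (\<integral>\<^sup>+x. ennreal (snd x powr \<alpha> * (norm (g x))\<^sup>2) \<partial>half_lborel) (1 / 2)
      * epowr (\<integral>\<^sup>+x. ennreal (snd x powr b * \<bar>u x\<bar> powr q) \<partial>half_lborel) (1 / 2)"
proof -
  have "(\<integral>\<^sup>+x. ennreal (snd x powr ((\<alpha> + b) / 2) * \<bar>u x\<bar> powr (q / 2) * norm (g x)) \<partial>half_lborel)
      = (\<integral>\<^sup>+x. epowr (ennreal (snd x powr \<alpha> * (norm (g x))\<^sup>2)) (1 / 2)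
      * epowr (ennreal (snd x powr b * \<bar>u x\<bar> powr q)) (1 / 2) \<partial>half_lborel)"
  proof (intro nn_integral_cong)
    fix x :: "(real ^ 'n) \<times> real"
    have "snd x powr ((\<alpha> + b) / 2) * \<bar>u x\<bar> powr (q / 2) * norm (g x)
        = (snd x powr (\<alpha> / 2) * norm (g x)) * (snd x powr (b / 2) * \<bar>u x\<bar> powr (q / 2))"
      by (simp add: add_divide_distrib powr_add)
    also have "\<dots> = (snd x powr \<alpha> * (norm (g x))\<^sup>2) powr (1 / 2) * (snd x powr b * \<bar>u x\<bar> powr q) powr (1 / 2)"
      by (simp add: powr_mult powr_powr powr_half_sqrt)
    finally show "ennreal (snd x powr ((\<alpha> + b) / 2) * \<bar>u x\<bar> powr (q / 2) * norm (g x))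
        = epowr (ennreal (snd x powr \<alpha> * (norm (g x))\<^sup>2)) (1 / 2)
        * epowr (ennreal (snd x powr b * \<bar>u x\<bar> powr q)) (1 / 2)"
      by (simp add: epowr_ennreal ennreal_mult[symmetric])
  qed
  also have "\<dots> \<le> epowr (\<integral>\<^sup>+x. ennreal (snd x powr \<alpha> * (norm (g x))\<^sup>2) \<partial>half_lborel) (1 / 2)
      * epowr (\<integral>\<^sup>+x. ennreal (snd x powr b * \<bar>u x\<bar> powr q) \<partial>half_lborel) (1 / 2)"
    by (intro nn_integral_Holder) auto
  finally show ?thesis .
qed

section \<open>Hardy's inequality and finiteness of weighted integrals\<close>

lemma nn_integral_powr_from_0:
  fixes b c :: real
  assumes "-1 < b" "0 \<le> c"
  shows "(\<integral>\<^sup>+t. ennreal (indicator {0..c} t * t powr b) \<partial>lborel) = ennreal (c powr (b + 1) / (b + 1))"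
  using nn_integral_has_integral_lebesgue[OF _ has_integral_powr_from_0[OF assms]] by simp

text \<open>For integrals without powers, Hardy's inequality is Tonelli's theorem: after the order
  of integration is exchanged, the inner integral of \<open>t powr b\<close> over
  \<open>0 < t \<le> r\<close> is explicit, and it converges because \<open>b > -1\<close>.\<close>

lemma Hardy_inequality_1d:
  fixes w h :: "real \<Rightarrow> ennreal"
  assumes [measurable]: "w \<in> borel_measurable borel" "h \<in> borel_measurable borel"
    and w: "\<And>t. w t \<le> (\<integral>\<^sup>+r. indicator {t..} r * h r \<partial>lborel)" and b: "-1 < b"
  shows "(\<integral>\<^sup>+t. ennreal (indicator {0<..} t * t powr b) * w t \<partial>lborel)
    \<le> (\<integral>\<^sup>+r. ennreal (indicator {0<..} r * (r powr (b + 1) / (b + 1))) * h r \<partial>lborel)"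
proof -
  have "(\<integral>\<^sup>+t. ennreal (indicator {0<..} t * t powr b) * w t \<partial>lborel)
      \<le> (\<integral>\<^sup>+t. ennreal (indicator {0<..} t * t powr b) * (\<integral>\<^sup>+r. indicator {t..} r * h r \<partial>lborel) \<partial>lborel)"
    by (intro nn_integral_mono mult_left_mono w) auto
  \<comment> \<open>Written in terms of \<open>r - t\<close>, the indicator is seen to be measurable
    in the pair \<open>(t, r)\<close>.\<close>
  also have "\<dots> = (\<integral>\<^sup>+t. (\<integral>\<^sup>+r. ennreal (indicator {0<..} t * t powr b) * (indicator {0..} (r - t) * h r) \<partial>lborel) \<partial>lborel)"
    by (subst nn_integral_cmult[symmetric]) (auto simp: indicator_def)
  also have "\<dots> = (\<integral>\<^sup>+r. (\<integral>\<^sup>+t. ennreal (indicator {0<..} t * t powr b) * (indicator {0..} (r - t) * h r) \<partial>lborel) \<partial>lborel)"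
    by (rule lborel_pair.Fubini') measurable
  also have "\<dots> = (\<integral>\<^sup>+r. ennreal (indicator {0<..} r * (r powr (b + 1) / (b + 1))) * h r \<partial>lborel)"
  proof (intro nn_integral_cong)
    fix r :: real
    show "(\<integral>\<^sup>+t. ennreal (indicator {0<..} t * t powr b) * (indicator {0..} (r - t) * h r) \<partial>lborel)
      = ennreal (indicator {0<..} r * (r powr (b + 1) / (b + 1))) * h r"
    proof (cases "0 < r")
      case True
      have "(\<integral>\<^sup>+t. ennreal (indicator {0<..} t * t powr b) * (indicator {0..} (r - t) * h r) \<partial>lborel)
          = (\<integral>\<^sup>+t. ennreal (indicator {0..r} t * t powr b) * h r \<partial>lborel)"
        by (intro nn_integral_cong) (auto simp: indicator_def)
      also have "\<dots> = ennreal (r powr (b + 1) / (b + 1)) * h r"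
        using True b by (simp add: nn_integral_multc nn_integral_powr_from_0)
      finally show ?thesis using True by simp
    next
      case False
      have "(\<integral>\<^sup>+t. ennreal (indicator {0<..} t * t powr b) * (indicator {0..} (r - t) * h r) \<partial>lborel)
          = (\<integral>\<^sup>+t. 0 \<partial>(lborel :: real measure))"
        using False by (intro nn_integral_cong) (auto simp: indicator_def)
      with False show ?thesis by simp
    qed
  qed
  finally show ?thesis .
qed

lemma nn_integral_half_lborel_prod:
  fixes f :: "(real ^ 'n) \<times> real \<Rightarrow> ennreal"
  assumes [measurable]: "f \<in> borel_measurable borel"
  shows "(\<integral>\<^sup>+x. f x \<partial>half_lborel) = (\<integral>\<^sup>+y. (\<integral>\<^sup>+t. indicator {0<..} t * f (y, t) \<partial>lborel) \<partial>lborel)"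
proof -
  have "(\<integral>\<^sup>+x. f x \<partial>half_lborel) = (\<integral>\<^sup>+x. indicator half_space x * f x \<partial>lborel)"
    by (subst nn_integral_density) auto
  also have "\<dots> = (\<integral>\<^sup>+x. indicator half_space x * f x \<partial>(lborel \<Otimes>\<^sub>M lborel))"
    by (simp add: lborel_prod)
  also have "\<dots> = (\<integral>\<^sup>+y. (\<integral>\<^sup>+t. indicator half_space (y, t) * f (y, t) \<partial>lborel) \<partial>lborel)"
    by (rule lborel.nn_integral_fst[symmetric]) (simp add: lborel_prod)
  also have "\<dots> = (\<integral>\<^sup>+y. (\<integral>\<^sup>+t. indicator {0<..} t * f (y, t) \<partial>lborel) \<partial>lborel)"
    by (intro nn_integral_cong) (auto simp: half_space_def indicator_def)
  finally show ?thesis .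
qed

text \<open>The one-dimensional inequality is applied to \<open>\<bar>u\<bar> powr q\<close> on each
  vertical line. The line integral runs away from the boundary to where \<open>u\<close> vanishes,
  so no boundary condition at \<open>t = 0\<close> arises.\<close>

lemma weighted_Hardy:
  fixes u :: "(real ^ 'n) \<times> real \<Rightarrow> real"
  assumes u: "C1_compact u g" and b: "-1 < b" and q: "1 < q"
  shows "(\<integral>\<^sup>+x. ennreal (snd x powr b * \<bar>u x\<bar> powr q) \<partial>half_lborel)
    \<le> ennreal (q / (b + 1))
      * (\<integral>\<^sup>+x. ennreal (snd x powr (b + 1) * \<bar>u x\<bar> powr (q - 1) * norm (g x)) \<partial>half_lborel)"
proof -
  note [measurable] = C1_compact_borel[OF u]
  define h where "h x = ennreal (q * \<bar>u x\<bar> powr (q - 1) * norm (g x))" for x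
  have [measurable]: "h \<in> borel_measurable borel" unfolding h_def by measurable
  have [measurable]: "(\<lambda>t. h (y, t)) \<in> borel_measurable borel" 
    "(\<lambda>t. u (y, t)) \<in> borel_measurable borel" for y
    by (rule measurable_compose[of _ _ borel]; measurable)+
  have line: "ennreal (\<bar>u (y, t)\<bar> powr q) \<le> (\<integral>\<^sup>+r. indicator {t..} r * h (y, r) \<partial>lborel)" for y t
  proof -
    have "ennreal (\<bar>u (y, t)\<bar> powr q) \<le> (\<integral>\<^sup>+r. indicator {0..} r * h (y, t + r) \<partial>lborel)"
      using abs_powr_le_line_integral[OF u q, of "(0, 1)" "(y, t)"]
      by (simp add: h_def indicator_mult_ennreal norm_Pair)
    also have "\<dots> = (\<integral>\<^sup>+r. indicator {t..} (t + 1 * r) * h (y, t + 1 * r) \<partial>lborel)"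
      by (intro nn_integral_cong) (auto simp: indicator_def)
    also have "\<dots> = (\<integral>\<^sup>+r. indicator {t..} r * h (y, r) \<partial>lborel)"
      by (subst nn_integral_real_affine[where c=1 and t=t and f="\<lambda>r. indicator {t..} r * h (y, r)"]) auto
    finally show ?thesis .
  qed
  have "(\<integral>\<^sup>+x. ennreal (snd x powr b * \<bar>u x\<bar> powr q) \<partial>half_lborel)
      = (\<integral>\<^sup>+y. (\<integral>\<^sup>+t. ennreal (indicator {0<..} t * t powr b) * ennreal (\<bar>u (y, t)\<bar> powr q) \<partial>lborel) \<partial>lborel)"
    by (subst nn_integral_half_lborel_prod)
       (auto intro!: nn_integral_cong simp: indicator_def ennreal_mult)
  also have "\<dots> \<le> (\<integral>\<^sup>+y. (\<integral>\<^sup>+t. ennreal (indicator {0<..} t * (t powr (b + 1) / (b + 1))) * h (y, t) \<partial>lborel) \<partial>lborel)"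
    by (intro nn_integral_mono Hardy_inequality_1d line b) measurable
  also have "\<dots> = (\<integral>\<^sup>+x. ennreal (snd x powr (b + 1) / (b + 1)) * h x \<partial>half_lborel)"
    by (subst nn_integral_half_lborel_prod)
       (auto intro!: nn_integral_cong simp: indicator_def)
  also have "\<dots> = (\<integral>\<^sup>+x. ennreal (q / (b + 1))
      * ennreal (snd x powr (b + 1) * \<bar>u x\<bar> powr (q - 1) * norm (g x)) \<partial>half_lborel)"
    using q b by (intro nn_integral_cong) (simp add: h_def ennreal_mult[symmetric] mult_ac)
  also have "\<dots> = ennreal (q / (b + 1))
      * (\<integral>\<^sup>+x. ennreal (snd x powr (b + 1) * \<bar>u x\<bar> powr (q - 1) * norm (g x)) \<partial>half_lborel)"
    by (rule nn_integral_cmult) measurable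
  finally show ?thesis .
qed

text \<open>The integrand is dominated on a cylinder over a ball with \<open>t\<close> in
  \<open>{0..S}\<close>; the only singularity is that of \<open>t powr b\<close> at
  \<open>0\<close>, integrable for \<open>b > -1\<close>.\<close>

lemma weighted_finite:
  fixes f :: "(real ^ 'n) \<times> real \<Rightarrow> real"
  assumes [measurable]: "f \<in> borel_measurable borel" and b: "-1 < b"
    and B: "\<And>x. f x \<le> B" and R: "\<And>x. R < norm x \<Longrightarrow> f x = 0"
  shows "(\<integral>\<^sup>+x. ennreal (snd x powr b * f x) \<partial>half_lborel) < top"
proof -
  define S where "S = max R 0"
  have S: "0 \<le> S" by (simp add: S_def)
  define D where "D = max B 0"
  have le: "indicator {0<..} t * ennreal (t powr b * f (y, t))
      \<le> ennreal D * indicator (cball 0 S) y * ennreal (indicator {0..S} t * t powr b)" for y t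
  proof (cases "0 < t \<and> norm (y, t) \<le> S")
    case True
    then have "norm y \<le> S" "t \<le> S"
      using norm_fst_le[of y t] norm_snd_le[of t y] by auto
    moreover have "t powr b * f (y, t) \<le> D * t powr b"
      using B[of "(y, t)"] by (simp add: D_def le_max_iff_disj mult.commute[of _ "f _"] mult_right_mono)
    ultimately show ?thesis
      using True by (simp add: D_def ennreal_mult[symmetric] ennreal_leI)
  next
    case False
    then show ?thesis using R[of "(y, t)"] by (auto simp: S_def indicator_def)
  qed
  have "(\<integral>\<^sup>+x. ennreal (snd x powr b * f x) \<partial>half_lborel)
      = (\<integral>\<^sup>+y. (\<integral>\<^sup>+t. indicator {0<..} t * ennreal (t powr b * f (y, t)) \<partial>lborel) \<partial>lborel)"
    by (subst nn_integral_half_lborel_prod) auto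
  also have "\<dots> \<le> (\<integral>\<^sup>+y. (\<integral>\<^sup>+t. ennreal D * indicator (cball (0 :: real ^ 'n) S) y * ennreal (indicator {0..S} t * t powr b) \<partial>lborel) \<partial>lborel)"
    by (intro nn_integral_mono le)
  also have "\<dots> = (\<integral>\<^sup>+y. ennreal D * ennreal (S powr (b + 1) / (b + 1)) * indicator (cball (0 :: real ^ 'n) S) y \<partial>lborel)"
    using b S by (intro nn_integral_cong)
      (simp add: nn_integral_cmult nn_integral_powr_from_0, simp add: mult_ac)
  also have "\<dots> = ennreal D * ennreal (S powr (b + 1) / (b + 1)) * emeasure lborel (cball (0 :: real ^ 'n) S)"
    by (rule nn_integral_cmult_indicator) simp
  also have "\<dots> < top"
    using emeasure_bounded_finite[OF bounded_cball] by (auto simp: ennreal_mult_less_top)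
  finally show ?thesis .
qed

section \<open>The weighted Sobolev inequality\<close>

text \<open>Gagliardo's inequality in dimension \<open>n + 1\<close> is applied to the weighted
  power of \<open>u\<close>, extended by \<open>0\<close> below the boundary. Along a forward
  coordinate ray \<open>t\<close> does not decrease, so for \<open>a \<ge> 0\<close> the weight at
  the starting point is at most the weight inside the line integral.\<close>

lemma weighted_Sobolev:
  fixes u :: "(real ^ 'n) \<times> real \<Rightarrow> real"
  assumes u: "C1_compact u g" and a: "0 \<le> a" and s: "1 < s"
  defines "q \<equiv> (real CARD('n) + 1) / real CARD('n)"
  shows "(\<integral>\<^sup>+x. ennreal (snd x powr (a * q) * \<bar>u x\<bar> powr (s * q)) \<partial>half_lborel)
    \<le> epowr (ennreal s * (\<integral>\<^sup>+x. ennreal (snd x powr a * \<bar>u x\<bar> powr (s - 1) * norm (g x)) \<partial>half_lborel)) q"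
proof -
  note [measurable] = C1_compact_borel[OF u]
  define v where "v x = ennreal (indicator half_space x * (snd x powr a * \<bar>u x\<bar> powr s))" for x
  define G where "G x = ennreal (indicator half_space x * (s * (snd x powr a * \<bar>u x\<bar> powr (s - 1) * norm (g x))))" for x
  have [measurable]: "v \<in> borel_measurable borel" "G \<in> borel_measurable borel"
    unfolding v_def G_def by measurable
  have q: "q = real DIM((real ^ 'n) \<times> real) / (real DIM((real ^ 'n) \<times> real) - 1)" "0 < q"
    by (simp_all add: q_def add_pos_pos)
  have lines: "v x \<le> (\<integral>\<^sup>+r. G (x + r *\<^sub>R b) \<partial>lborel)" if b: "b \<in> Basis" for x b
  proof (cases "x \<in> half_space")
    case True
    have nb: "norm b = 1" and sb: "0 \<le> snd b" using b by (auto simp: Basis_prod_def)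
    have "v x = ennreal (snd x powr a) * ennreal (\<bar>u x\<bar> powr s)"
      using True by (simp add: v_def ennreal_mult)
    also have "\<dots> \<le> ennreal (snd x powr a) * (\<integral>\<^sup>+r. ennreal (indicator {0..} r * (s * \<bar>u (x + r *\<^sub>R b)\<bar> powr (s - 1) * norm (g (x + r *\<^sub>R b)))) \<partial>lborel)"
      by (intro mult_left_mono abs_powr_le_line_integral[OF u s nb]) auto
    also have "\<dots> = (\<integral>\<^sup>+r. ennreal (snd x powr a) * ennreal (indicator {0..} r * (s * \<bar>u (x + r *\<^sub>R b)\<bar> powr (s - 1) * norm (g (x + r *\<^sub>R b)))) \<partial>lborel)"
      by (subst nn_integral_cmult) auto
    also have "\<dots> \<le> (\<integral>\<^sup>+r. G (x + r *\<^sub>R b) \<partial>lborel)"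
    proof (intro nn_integral_mono)
      fix r :: real
      show "ennreal (snd x powr a) * ennreal (indicator {0..} r * (s * \<bar>u (x + r *\<^sub>R b)\<bar> powr (s - 1) * norm (g (x + r *\<^sub>R b)))) \<le> G (x + r *\<^sub>R b)"
      proof (cases "0 \<le> r")
        case r: True
        have x: "0 < snd x" using True by (simp add: half_space_def)
        have "0 \<le> r * snd b" using r sb by simp
        with x have le: "snd x \<le> snd x + r * snd b" "x + r *\<^sub>R b \<in> half_space"
          by (auto simp: half_space_def)
        have "snd x powr a * (s * \<bar>u (x + r *\<^sub>R b)\<bar> powr (s - 1) * norm (g (x + r *\<^sub>R b)))
            \<le> (snd x + r * snd b) powr a * (s * \<bar>u (x + r *\<^sub>R b)\<bar> powr (s - 1) * norm (g (x + r *\<^sub>R b)))"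
          using x le a s by (intro mult_right_mono powr_mono2) auto
        with r le s show ?thesis
          by (simp add: G_def ennreal_mult[symmetric] mult_ac)
      qed simp
    qed
    finally show ?thesis .
  qed (simp add: v_def)
  have "(\<integral>\<^sup>+x. ennreal (snd x powr (a * q) * \<bar>u x\<bar> powr (s * q)) \<partial>half_lborel)
      = (\<integral>\<^sup>+x. epowr (v x) q \<partial>lborel)"
    using q(2) by (subst nn_integral_density)
      (auto intro!: nn_integral_cong simp: v_def epowr_ennreal powr_mult powr_powr indicator_def half_space_def)
  also have "\<dots> \<le> epowr (\<integral>\<^sup>+x. G x \<partial>lborel) q"
    unfolding q(1) by (rule Gagliardo_inequality) (auto intro: lines)
  also have "(\<integral>\<^sup>+x. G x \<partial>lborel) = (\<integral>\<^sup>+x. ennreal s * ennreal (snd x powr a * \<bar>u x\<bar> powr (s - 1) * norm (g x)) \<partial>half_lborel)"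
    using s by (subst nn_integral_density)
      (auto intro!: nn_integral_cong simp: G_def ennreal_mult[symmetric] indicator_def)
  also have "\<dots> = ennreal s * (\<integral>\<^sup>+x. ennreal (snd x powr a * \<bar>u x\<bar> powr (s - 1) * norm (g x)) \<partial>half_lborel)"
    by (rule nn_integral_cmult) measurable
  finally show ?thesis .
qed

section \<open>Energy estimates obtained from Hardy and Sobolev\<close>

context
  fixes \<alpha> :: real and u :: "(real ^ 'n) \<times> real \<Rightarrow> real" and g
  assumes u: "C1_compact u g"
begin

private abbreviation "J b r \<equiv> (\<integral>\<^sup>+x. ennreal (snd x powr b * \<bar>u x\<bar> powr r) \<partial>half_lborel)"
private abbreviation "E \<equiv> (\<integral>\<^sup>+x. ennreal (snd x powr \<alpha> * (norm (g x))\<^sup>2) \<partial>half_lborel)"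

text \<open>With the power \<open>r / 2 + 1\<close>, Hardy's inequality leaves
  \<open>\<bar>u\<bar> powr (r / 2)\<close> beside the gradient, the square root of what occurs in
  \<open>J c r\<close>. The condition \<open>- \<alpha> < c\<close> says that the exponent of
  Hardy's inequality exceeds \<open>-1\<close>.\<close>

lemma weighted_energy_Hardy:
  assumes "- \<alpha> < c" "0 < r"
  shows "J ((c + \<alpha> - 2) / 2) (r / 2 + 1)
    \<le> ennreal ((r + 2) / (c + \<alpha>)) * epowr (E * J c r) (1 / 2)"
proof -
  note [measurable] = C1_compact_borel[OF u]
  have e: "(c + \<alpha> - 2) / 2 + 1 = (\<alpha> + c) / 2" "(r / 2 + 1) / ((\<alpha> + c) / 2) = (r + 2) / (c + \<alpha>)"
    "r / 2 + 1 - 1 = r / 2"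
    using assms by (auto simp: field_simps)
  have "J ((c + \<alpha> - 2) / 2) (r / 2 + 1) \<le> ennreal ((r + 2) / (c + \<alpha>))
      * (\<integral>\<^sup>+x. ennreal (snd x powr ((\<alpha> + c) / 2) * \<bar>u x\<bar> powr (r / 2) * norm (g x)) \<partial>half_lborel)"
    using weighted_Hardy[OF u, of "(c + \<alpha> - 2) / 2" "r / 2 + 1"] assms unfolding e by simp
  also have "(\<integral>\<^sup>+x. ennreal (snd x powr ((\<alpha> + c) / 2) * \<bar>u x\<bar> powr (r / 2) * norm (g x)) \<partial>half_lborel)
      \<le> epowr (E * J c r) (1 / 2)"
    by (subst epowr_mult, simp, rule weighted_Cauchy_Schwarz) measurable
  finally show ?thesis by (simp add: mult_left_mono)
qed

text \<open>The same power and the same Cauchy-Schwarz step as for Hardy's inequality; now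
  \<open>- \<alpha> \<le> c\<close> makes the weight \<open>(\<alpha> + c) / 2\<close> nonnegative,
  as the Sobolev inequality requires.\<close>

lemma weighted_energy_Sobolev:
  assumes "- \<alpha> \<le> c" "0 < r"
  defines "q \<equiv> (real CARD('n) + 1) / real CARD('n)"
  shows "J ((\<alpha> + c) / 2 * q) ((r / 2 + 1) * q)
    \<le> ennreal ((r / 2 + 1) powr q) * epowr (E * J c r) (q / 2)"
proof -
  note [measurable] = C1_compact_borel[OF u]
  have q: "0 < q" by (simp add: q_def add_pos_pos)
  have e: "r / 2 + 1 - 1 = r / 2" by simp
  have "J ((\<alpha> + c) / 2 * q) ((r / 2 + 1) * q) \<le> epowr (ennreal (r / 2 + 1)
      * (\<integral>\<^sup>+x. ennreal (snd x powr ((\<alpha> + c) / 2) * \<bar>u x\<bar> powr (r / 2) * norm (g x)) \<partial>half_lborel)) q"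
    using weighted_Sobolev[OF u, of "(\<alpha> + c) / 2" "r / 2 + 1"] assms unfolding e by simp
  also have "\<dots> \<le> epowr (ennreal (r / 2 + 1) * epowr (E * J c r) (1 / 2)) q"
    using q
    by (intro epowr_mono mult_left_mono, simp_all, subst epowr_mult, simp, intro weighted_Cauchy_Schwarz) measurable
  also have "\<dots> = epowr (ennreal (r / 2 + 1)) q * epowr (E * J c r) (1 / 2 * q)"
    using q by (simp only: epowr_mult epowr_epowr less_imp_le)
  also have "epowr (ennreal (r / 2 + 1)) q = ennreal ((r / 2 + 1) powr q)"
    using q assms(2) by (intro epowr_ennreal) auto
  finally show ?thesis by simp
qed

lemma weighted_power_finite:
  assumes "-1 < b" "0 < r"
  shows "J b r < top"
proof -
  note [measurable] = C1_compact_borel[OF u]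
  obtain B where B: "\<forall>x. \<bar>u x\<bar> \<le> B \<and> norm (g x) \<le> B"
    using C1_compact_bounded[OF u] by blast
  obtain R where R: "\<forall>x. norm x > R \<longrightarrow> u x = 0 \<and> g x = 0"
    using C1_compact_support[OF u] by blast
  show ?thesis
    by (rule weighted_finite[where B="B powr r" and R=R])
       (use assms B R in \<open>auto intro!: powr_mono2\<close>)
qed

lemma weighted_energy_finite:
  assumes "-1 < \<alpha>"
  shows "E < top"
proof -
  note [measurable] = C1_compact_borel[OF u]
  obtain B where B: "\<forall>x. \<bar>u x\<bar> \<le> B \<and> norm (g x) \<le> B"
    using C1_compact_bounded[OF u] by blast
  obtain R where R: "\<forall>x. norm x > R \<longrightarrow> u x = 0 \<and> g x = 0"
    using C1_compact_support[OF u] by blast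
  show ?thesis
    by (rule weighted_finite[where B="B\<^sup>2" and R=R])
       (use assms B R in \<open>auto intro!: power_mono\<close>)
qed

end

section \<open>The inequality for functions of class \<open>C1\<close>, by interpolation and
  absorption\<close>

lemma weighted_inequality_upper_range:
  fixes \<alpha> c :: real
  defines "n \<equiv> real CARD('n::finite)"
  defines "r \<equiv> (2 * n + 2 * c + 2) / (n + \<alpha> - 1)"
  assumes \<alpha>: "0 < \<alpha>" and c: "- \<alpha> < c" "-1 < c" "\<alpha> \<le> c + 2" "(n - 1) * c \<le> (n + 1) * \<alpha>"
  shows "\<exists>C>0. \<forall>u g. C1_compact (u :: (real ^ 'n) \<times> real \<Rightarrow> real) g \<longrightarrow>
    (\<integral>\<^sup>+x. ennreal (snd x powr c * \<bar>u x\<bar> powr r) \<partial>half_lborel)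
      \<le> ennreal C * epowr (\<integral>\<^sup>+x. ennreal (snd x powr \<alpha> * (norm (g x))\<^sup>2) \<partial>half_lborel) (r / 2)"
proof -
  define q where "q = (n + 1) / n"
  \<comment> \<open>\<open>\<theta>\<close> is the relative position of \<open>c\<close> between the
    Hardy exponent \<open>(c + \<alpha> - 2) / 2\<close> and the Sobolev exponent
    \<open>(\<alpha> + c) / 2 * q\<close>.\<close>
  define \<theta> where "\<theta> = n * (c - \<alpha> + 2) / (\<alpha> + c + 2 * n)"
  \<comment> \<open>\<open>\<kappa>\<close> is the power of the product of energy and
    \<open>J c r\<close> that results from interpolating the powers \<open>1 / 2\<close> and
    \<open>q / 2\<close>.\<close>
  define \<kappa> where "\<kappa> = (c + 1 + n) / (\<alpha> + c + 2 * n)"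
  define K1 where "K1 = (r + 2) / (c + \<alpha>)"
  define K2 where "K2 = (r / 2 + 1) powr q"
  define K where "K = K1 powr (1 - \<theta>) * K2 powr \<theta>"
  define C where "C = K powr (1 / (1 - \<kappa>))"
  have n: "1 \<le> n" by (simp add: n_def Suc_le_eq)
  have pos: "0 < n + \<alpha> - 1" "0 < \<alpha> + c + 2 * n" "0 < 2 * n + 2 * c + 2" "0 < c + 1 + n"
    using n \<alpha> c by auto
  have r: "0 < r" using pos by (simp add: r_def)
  have q: "0 < q" using n by (simp add: q_def)
  \<comment> \<open>The bound \<open>\<alpha> \<le> c + 2\<close> is equivalent to
    \<open>0 \<le> \<theta>\<close>, and the other constraint on \<open>c\<close> to
    \<open>\<theta> \<le> 1\<close>.\<close>
  have "0 \<le> n * (c - \<alpha> + 2)" using n c by simp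
  moreover have "n * (c - \<alpha> + 2) \<le> \<alpha> + c + 2 * n"
    using c(4) by (simp add: algebra_simps)
  ultimately have \<theta>: "0 \<le> \<theta>" "\<theta> \<le> 1"
    using pos(2) unfolding \<theta>_def by (simp_all only: divide_nonneg_pos divide_le_eq_1_pos)
  \<comment> \<open>The second bound amounts to \<open>0 < n + \<alpha> - 1\<close>.\<close>
  have \<kappa>: "0 < \<kappa>" "\<kappa> < 1" using pos by (auto simp: \<kappa>_def field_simps)
  have \<kappa>_eq: "\<kappa> = (1 - \<theta>) * (1 / 2) + \<theta> * (q / 2)"
    using pos n by (simp add: \<kappa>_def \<theta>_def q_def divide_simps) (simp add: algebra_simps)
  have c_eq: "c = (1 - \<theta>) * ((c + \<alpha> - 2) / 2) + \<theta> * ((\<alpha> + c) / 2 * q)"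
    using pos n by (simp add: \<theta>_def q_def divide_simps) (simp add: algebra_simps)
  have r_mult: "r * (n + \<alpha> - 1) = 2 * (c + 1 + n)"
    using pos(1) by (simp add: r_def)
  have \<kappa>_mult: "\<kappa> * (\<alpha> + c + 2 * n) = c + 1 + n"
    using pos(2) by (simp add: \<kappa>_def)
  \<comment> \<open>The identity \<open>\<kappa> * (r + 2) = r\<close> is homogeneity: under scaling
    of \<open>u\<close> the integral \<open>J c r\<close> and the power \<open>\<kappa>\<close> of
    its product with the energy must scale alike.\<close>
  have "(\<kappa> * (r + 2)) * (n + \<alpha> - 1) = r * (n + \<alpha> - 1)"
    using r_mult \<kappa>_mult by algebra
  then have \<kappa>_r: "\<kappa> * (r + 2) = r" using pos(1) by simp
  \<comment> \<open>The \<open>\<theta>\<close> fixed by the weights also interpolates the powers of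
    \<open>u\<close>, since
    \<open>(r / 2 + 1) * (2 * \<kappa>) = \<kappa> * (r + 2) = r\<close>.\<close>
  have "1 - \<theta> + \<theta> * q = 2 * \<kappa>"
    unfolding \<kappa>_eq by algebra
  then have r_eq: "r = (1 - \<theta>) * (r / 2 + 1) + \<theta> * ((r / 2 + 1) * q)"
    using \<kappa>_r by algebra
  have "2 * \<kappa> = r * (1 - \<kappa>)" using \<kappa>_r by (simp add: algebra_simps)
  then have \<kappa>_quot: "\<kappa> / (1 - \<kappa>) = r / 2"
    using \<kappa> by (simp add: nonzero_divide_eq_eq)
  have K: "0 < K1" "0 < K2" "0 < K" using r c by (auto simp: K1_def K2_def K_def)
  show ?thesis
  proof (intro exI[of _ C] conjI allI impI)
    show "0 < C" using K by (simp add: C_def)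
  next
    fix u :: "(real ^ 'n) \<times> real \<Rightarrow> real" and g
    assume u: "C1_compact u g"
    note [measurable] = C1_compact_borel[OF u]
    let ?J = "\<lambda>b r. (\<integral>\<^sup>+x. ennreal (snd x powr b * \<bar>u x\<bar> powr r) \<partial>half_lborel)"
    let ?E = "(\<integral>\<^sup>+x. ennreal (snd x powr \<alpha> * (norm (g x))\<^sup>2) \<partial>half_lborel)"
    let ?X = "?E * ?J c r"
    have H: "?J ((c + \<alpha> - 2) / 2) (r / 2 + 1) \<le> ennreal K1 * epowr ?X (1 / 2)"
      unfolding K1_def by (rule weighted_energy_Hardy[OF u c(1) r])
    have S: "?J ((\<alpha> + c) / 2 * q) ((r / 2 + 1) * q) \<le> ennreal K2 * epowr ?X (q / 2)"
      unfolding K2_def q_def n_def by (rule weighted_energy_Sobolev[OF u]) (use c r in auto)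
    have "?J c r \<le> epowr (?J ((c + \<alpha> - 2) / 2) (r / 2 + 1)) (1 - \<theta>) * epowr (?J ((\<alpha> + c) / 2 * q) ((r / 2 + 1) * q)) \<theta>"
      by (rule weighted_interpolation[OF _ \<theta> c_eq r_eq]) measurable
    also have "\<dots> \<le> epowr (ennreal K1 * epowr ?X (1 / 2)) (1 - \<theta>) * epowr (ennreal K2 * epowr ?X (q / 2)) \<theta>"
      using \<theta> by (intro mult_mono epowr_mono H S) auto
    also have "\<dots> = ennreal K * epowr ?X \<kappa>"
    proof -
      have "epowr ?X \<kappa> = epowr ?X ((1 / 2) * (1 - \<theta>)) * epowr ?X ((q / 2) * \<theta>)"
        using \<theta> q by (subst epowr_add[symmetric]) (auto simp: \<kappa>_eq mult.commute)
      moreover have "ennreal K = epowr (ennreal K1) (1 - \<theta>) * epowr (ennreal K2) \<theta>"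
        using K by (cases "\<theta> = 0 \<or> \<theta> = 1") (auto simp: K_def epowr_ennreal ennreal_mult)
      ultimately show ?thesis
        using \<theta> by (simp add: epowr_mult epowr_epowr mult_ac)
    qed
    \<comment> \<open>Compact support and \<open>-1 < c\<close> make the integral finite beforehand,
      so its power on the right can be absorbed.\<close>
    finally have "?J c r \<le> ennreal C * epowr ?E (\<kappa> / (1 - \<kappa>))"
      unfolding C_def using weighted_power_finite[OF u c(2) r] K \<kappa>
      by (intro epowr_absorb) auto
    then show "?J c r \<le> ennreal C * epowr ?E (r / 2)" by (simp only: \<kappa>_quot)
  qed
qed

text \<open>For \<open>b \<le> - \<alpha>\<close> the exponent \<open>(b + \<alpha> - 2) / 2\<close>
  in Hardy's inequality would be at most \<open>-1\<close>, so the estimate is derived from one at a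
  larger exponent instead.\<close>

theorem weighted_inequality_C1:
  fixes \<alpha> b :: real
  defines "n \<equiv> real CARD('n::finite)"
  defines "r \<equiv> (2 * n + 2 * b + 2) / (n + \<alpha> - 1)"
  assumes \<alpha>: "0 < \<alpha>" and b: "-1 < b" "\<alpha> \<le> b + 2" "(n - 1) * b \<le> (n + 1) * \<alpha>"
  shows "\<exists>C>0. \<forall>u g. C1_compact (u :: (real ^ 'n) \<times> real \<Rightarrow> real) g \<longrightarrow>
    (\<integral>\<^sup>+x. ennreal (snd x powr b * \<bar>u x\<bar> powr r) \<partial>half_lborel)
      \<le> ennreal C * epowr (\<integral>\<^sup>+x. ennreal (snd x powr \<alpha> * (norm (g x))\<^sup>2) \<partial>half_lborel) (r / 2)"
proof (cases "- \<alpha> < b")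
  case True
  with \<alpha> b show ?thesis
    unfolding r_def n_def by (intro weighted_inequality_upper_range) auto
next
  case False
  \<comment> \<open>Hardy's inequality leads from an exponent \<open>c\<close> of the upper range to an exponent \<open>b0 \<le> b\<close>.\<close>
  define c where "c = min (2 * b + 2 - \<alpha>) 0"
  define b0 where "b0 = (c + \<alpha> - 2) / 2"
  define s where "s = (2 * n + 2 * c + 2) / (n + \<alpha> - 1)"
  define \<theta> where "\<theta> = (b - b0) / (c - b0)"
  have n: "1 \<le> n" by (simp add: n_def Suc_le_eq)
  have \<alpha>1: "\<alpha> < 1" using False b by simp
  \<comment> \<open>The value \<open>2 * b + 2 - \<alpha>\<close> would give \<open>b0 = b\<close>,
    and it exceeds \<open>- \<alpha>\<close> because \<open>-1 < b\<close>. Capping at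
    \<open>0\<close> secures the upper constraint, whose left side is then nonpositive.\<close>
  have c: "- \<alpha> < c" "-1 < c" "\<alpha> \<le> c + 2" "(n - 1) * c \<le> (n + 1) * \<alpha>"
    using \<alpha> \<alpha>1 b False n by (auto simp: c_def mult_nonneg_nonpos intro: order_trans[of _ 0])
  have b0: "b0 \<le> b" "b < c" "b0 < c"
    using False c \<alpha> b by (auto simp: b0_def c_def)
  have pos: "0 < n + \<alpha> - 1" using n \<alpha> by simp
  have s: "0 < s" using pos n c by (simp add: s_def)
  have r: "0 < r" using pos n b by (simp add: r_def)
  have \<theta>: "0 \<le> \<theta>" "\<theta> \<le> 1" using b0 by (auto simp: \<theta>_def)
  have b_eq: "b = (1 - \<theta>) * b0 + \<theta> * c"
    using b0 by (simp add: \<theta>_def divide_simps) (simp add: algebra_simps)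
  \<comment> \<open>The critical power is affine in the weight exponent and equals
    \<open>s / 2 + 1\<close> at \<open>b0\<close> and \<open>s\<close> at \<open>c\<close>, so
    \<open>\<theta>\<close> interpolates the powers too.\<close>
  have "r * (n + \<alpha> - 1) = 2 * n + 2 * b + 2" "s * (n + \<alpha> - 1) = 2 * n + 2 * c + 2" "2 * b0 = c + \<alpha> - 2"
    using pos by (simp_all add: r_def s_def b0_def)
  then have "r * (n + \<alpha> - 1) = ((1 - \<theta>) * (s / 2 + 1) + \<theta> * s) * (n + \<alpha> - 1)"
    using b_eq by algebra
  then have r_eq: "r = (1 - \<theta>) * (s / 2 + 1) + \<theta> * s"
    using pos by simp
  obtain C where C: "0 < C" "\<And>u g. C1_compact (u :: (real ^ 'n) \<times> real \<Rightarrow> real) g \<Longrightarrow>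
    (\<integral>\<^sup>+x. ennreal (snd x powr c * \<bar>u x\<bar> powr s) \<partial>half_lborel)
      \<le> ennreal C * epowr (\<integral>\<^sup>+x. ennreal (snd x powr \<alpha> * (norm (g x))\<^sup>2) \<partial>half_lborel) (s / 2)"
    using weighted_inequality_upper_range[where 'n='n, of \<alpha> c] \<alpha> c unfolding s_def n_def by blast
  define K where "K = (s + 2) / (c + \<alpha>)"
  define D where "D = (K * C powr (1 / 2)) powr (1 - \<theta>) * C powr \<theta>"
  have K: "0 < K" using s c by (simp add: K_def)
  then have KC: "0 < K * C powr (1 / 2)" using C(1) by simp
  show ?thesis
  proof (intro exI[of _ D] conjI allI impI)
    show "0 < D" using K C by (simp add: D_def)
  next
    fix u :: "(real ^ 'n) \<times> real \<Rightarrow> real" and g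
    assume u: "C1_compact u g"
    note [measurable] = C1_compact_borel[OF u]
    let ?J = "\<lambda>b r. (\<integral>\<^sup>+x. ennreal (snd x powr b * \<bar>u x\<bar> powr r) \<partial>half_lborel)"
    let ?E = "(\<integral>\<^sup>+x. ennreal (snd x powr \<alpha> * (norm (g x))\<^sup>2) \<partial>half_lborel)"
    have J_c: "?J c s \<le> ennreal C * epowr ?E (s / 2)" by (rule C(2)[OF u])
    \<comment> \<open>Inserting the known bound at \<open>c\<close> leaves only the energy on the
      right, so nothing has to be absorbed in this range.\<close>
    have "?J b0 (s / 2 + 1) \<le> ennreal K * epowr (?E * ?J c s) (1 / 2)"
      unfolding K_def b0_def by (rule weighted_energy_Hardy[OF u c(1) s])
    also have "\<dots> \<le> ennreal K * epowr (?E * (ennreal C * epowr ?E (s / 2))) (1 / 2)"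
      by (intro mult_left_mono epowr_mono J_c) auto
    also have "?E * (ennreal C * epowr ?E (s / 2)) = ennreal C * epowr ?E (s / 2 + 1)"
      using s by (simp add: epowr_add mult_ac)
    also have "ennreal K * epowr (ennreal C * epowr ?E (s / 2 + 1)) (1 / 2)
        = ennreal (K * C powr (1 / 2)) * epowr ?E ((s / 2 + 1) / 2)"
      using K C by (simp add: epowr_mult epowr_epowr epowr_ennreal ennreal_mult mult_ac)
    finally have J_b0: "?J b0 (s / 2 + 1) \<le> ennreal (K * C powr (1 / 2)) * epowr ?E ((s / 2 + 1) / 2)" .
    have "?J b r \<le> epowr (?J b0 (s / 2 + 1)) (1 - \<theta>) * epowr (?J c s) \<theta>"
      by (rule weighted_interpolation[OF _ \<theta> b_eq r_eq]) measurable
    also have "\<dots> \<le> epowr (ennreal (K * C powr (1 / 2)) * epowr ?E ((s / 2 + 1) / 2)) (1 - \<theta>)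
        * epowr (ennreal C * epowr ?E (s / 2)) \<theta>"
      using \<theta> by (intro mult_mono epowr_mono J_c J_b0) auto
    also have "\<dots> = ennreal D * epowr ?E (r / 2)"
    proof -
      have r2: "r / 2 = (s / 2 + 1) / 2 * (1 - \<theta>) + s / 2 * \<theta>"
        by (simp add: r_eq add_divide_distrib mult.commute)
      have "epowr ?E (r / 2) = epowr ?E ((s / 2 + 1) / 2 * (1 - \<theta>)) * epowr ?E (s / 2 * \<theta>)"
        unfolding r2 using \<theta> s by (intro epowr_add) auto
      moreover have "ennreal D = epowr (ennreal (K * C powr (1 / 2))) (1 - \<theta>) * epowr (ennreal C) \<theta>"
        using KC C(1) by (simp only: D_def epowr_ennreal_pos ennreal_mult powr_ge_zero)
      ultimately show ?thesis
        using \<theta> by (simp add: epowr_mult epowr_epowr mult_ac)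
    qed
    finally show "?J b r \<le> ennreal D * epowr ?E (r / 2)" .
  qed
qed

section \<open>Completeness of \<open>L\<^sup>p\<close>\<close>

text \<open>A triangle inequality up to the factor \<open>2 powr p\<close>, without roots: it covers
  every \<open>p > 0\<close> and also infinite integrals.\<close>

lemma nn_integral_norm_powr_triangle:
  fixes a b c :: "'a \<Rightarrow> 'b::{real_normed_vector, second_countable_topology}"
  assumes [measurable]: "a \<in> borel_measurable M" "b \<in> borel_measurable M" "c \<in> borel_measurable M"
    and p: "0 < p"
  shows "(\<integral>\<^sup>+x. ennreal (norm (a x - c x) powr p) \<partial>M)
    \<le> ennreal (2 powr p) * ((\<integral>\<^sup>+x. ennreal (norm (a x - b x) powr p) \<partial>M)
      + (\<integral>\<^sup>+x. ennreal (norm (b x - c x) powr p) \<partial>M))"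
proof -
  have "ennreal (norm (a x - c x) powr p) \<le> ennreal (2 powr p) *
      (ennreal (norm (a x - b x) powr p) + ennreal (norm (b x - c x) powr p))" for x
  proof -
    have "norm (a x - c x) \<le> norm (a x - b x) + norm (b x - c x)"
      using norm_triangle_ineq[of "a x - b x" "b x - c x"] by simp
    then have "epowr (ennreal (norm (a x - c x))) p
        \<le> epowr (ennreal (norm (a x - b x)) + ennreal (norm (b x - c x))) p"
      using p by (intro epowr_mono) (auto simp: ennreal_plus[symmetric] simp del: ennreal_plus)
    also note epowr_add_le
    finally show ?thesis using p by (simp add: epowr_ennreal)
  qed
  then have "(\<integral>\<^sup>+x. ennreal (norm (a x - c x) powr p) \<partial>M) \<le> (\<integral>\<^sup>+x. ennreal (2 powr p) *
      (ennreal (norm (a x - b x) powr p) + ennreal (norm (b x - c x) powr p)) \<partial>M)"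
    by (rule nn_integral_mono)
  also have "\<dots> = ennreal (2 powr p) * ((\<integral>\<^sup>+x. ennreal (norm (a x - b x) powr p) \<partial>M)
      + (\<integral>\<^sup>+x. ennreal (norm (b x - c x) powr p) \<partial>M))"
    by (simp add: nn_integral_cmult nn_integral_add)
  finally show ?thesis .
qed

lemma convergent_if_geometric_steps:
  fixes f :: "nat \<Rightarrow> 'b::banach"
  assumes "\<And>i. norm (f (Suc i) - f i) \<le> C * (1 / 2) ^ i"
  shows "convergent f"
proof -
  have "summable (\<lambda>i. f (Suc i) - f i)"
    by (rule summable_comparison_test'[of "\<lambda>i. C * (1 / 2) ^ i" 0])
       (use assms in \<open>auto intro!: summable_mult summable_geometric\<close>)
  then have "convergent (\<lambda>n. f n - f 0)"
    by (simp add: summable_iff_convergent sum_lessThan_telescope)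
  from convergent_add[OF this convergent_const[of "f 0"]] show ?thesis by simp
qed

text \<open>The Riesz-Fischer argument: a rapidly Cauchy subsequence has steps that are
  geometrically small at almost every point, hence converges almost everywhere, and Fatou's lemma
  upgrades this to convergence of the whole sequence in the mean.\<close>

lemma Lp_complete:
  fixes f :: "nat \<Rightarrow> 'a \<Rightarrow> 'b::{banach, second_countable_topology}"
  assumes f [measurable]: "\<And>k. f k \<in> borel_measurable M" and p: "0 < p"
    and Cauchy: "\<And>e::real. 0 < e \<Longrightarrow> \<exists>N. \<forall>j\<ge>N. \<forall>k\<ge>N.
      (\<integral>\<^sup>+x. ennreal (norm (f j x - f k x) powr p) \<partial>M) \<le> ennreal e"
  shows "\<exists>g \<in> borel_measurable M. (\<lambda>k. \<integral>\<^sup>+x. ennreal (norm (f k x - g x) powr p) \<partial>M) \<longlonglongrightarrow> 0"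
proof -
  let ?D = "\<lambda>j k. \<integral>\<^sup>+x. ennreal (norm (f j x - f k x) powr p) \<partial>M"
  \<comment> \<open>Multiplied by \<open>(2 ^ i) powr p\<close>, the factor of the amplified steps
    below, this leaves the summable \<open>(1 / 2) ^ i\<close>.\<close>
  define e where "e i = (1 / 2) powr (real i * (p + 1))" for i :: nat
  have "\<forall>i. \<exists>N. \<forall>j\<ge>N. \<forall>k\<ge>N. ?D j k \<le> ennreal (e i)"
    using Cauchy by (simp add: e_def)
  then obtain N where N: "\<And>i j k. N i \<le> j \<Longrightarrow> N i \<le> k \<Longrightarrow> ?D j k \<le> ennreal (e i)"
    by metis
  \<comment> \<open>The sum dominates every \<open>N l\<close> with \<open>l \<le> i\<close>, so
    \<open>N i\<close> bounds both \<open>s i\<close> and \<open>s (Suc i)\<close> from below; the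
    summand \<open>i\<close> makes \<open>s\<close> unbounded.\<close>
  define s where "s i = (\<Sum>l\<le>i. N l) + i" for i
  have N_le: "N l \<le> s i" if "l \<le> i" for l i
    unfolding s_def using that by (intro trans_le_add1 member_le_sum) auto
  have s: "N i \<le> s i" "N i \<le> s (Suc i)" "i \<le> s i" for i
    using N_le[of i i] N_le[of i "Suc i"] by (auto simp: s_def)
  \<comment> \<open>\<open>lim\<close> is total, so \<open>g\<close> is measurable everywhere; its
    values on the null set of divergence are irrelevant.\<close>
  define g where "g x = lim (\<lambda>i. f (s i) x)" for x
  have g [measurable]: "g \<in> borel_measurable M"
    unfolding g_def by measurable
  have "(\<integral>\<^sup>+x. (\<Sum>i. ennreal ((2 ^ i * norm (f (s (Suc i)) x - f (s i) x)) powr p)) \<partial>M)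
      = (\<Sum>i. \<integral>\<^sup>+x. ennreal ((2 ^ i * norm (f (s (Suc i)) x - f (s i) x)) powr p) \<partial>M)"
    by (rule nn_integral_suminf) measurable
  also have "\<dots> \<le> (\<Sum>i. ennreal ((1 / 2) ^ i))"
  proof (rule suminf_le)
    fix i
    have "(\<integral>\<^sup>+x. ennreal ((2 ^ i * norm (f (s (Suc i)) x - f (s i) x)) powr p) \<partial>M)
        = ennreal ((2 ^ i) powr p) * ?D (s (Suc i)) (s i)"
      by (subst nn_integral_cmult[symmetric], measurable)
         (simp add: powr_mult ennreal_mult[symmetric])
    also have "\<dots> \<le> ennreal ((2 ^ i) powr p) * ennreal (e i)"
      using s by (intro mult_left_mono N) auto
    also have "\<dots> = ennreal ((1 / 2) ^ i)"
    proof -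
      have "(2 ^ i) powr p * e i = (1 / 2) ^ i"
        by (simp add: e_def powr_realpow[symmetric] powr_powr powr_divide powr_add[symmetric]
            distrib_left powr_minus_divide[symmetric] powr_add)
      then show ?thesis by (simp add: ennreal_mult[symmetric] e_def)
    qed
    finally show "(\<integral>\<^sup>+x. ennreal ((2 ^ i * norm (f (s (Suc i)) x - f (s i) x)) powr p) \<partial>M) \<le> ennreal ((1 / 2) ^ i)" .
  qed auto
  also have "\<dots> = ennreal (\<Sum>i. (1 / 2) ^ i)"
    by (rule suminf_ennreal2) (auto intro: summable_geometric)
  also have "\<dots> < top" by simp
  finally have "AE x in M. (\<Sum>i. ennreal ((2 ^ i * norm (f (s (Suc i)) x - f (s i) x)) powr p)) \<noteq> \<infinity>"
    by (intro nn_integral_PInf_AE) (auto simp: less_top)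
  then have lim: "AE x in M. (\<lambda>i. f (s i) x) \<longlonglongrightarrow> g x"
  proof eventually_elim
    case (elim x)
    define c where "c i = 2 ^ i * norm (f (s (Suc i)) x - f (s i) x)" for i
    define S where "S = enn2real (\<Sum>i. ennreal (c i powr p))"
    have "(\<Sum>i. ennreal (c i powr p)) < top"
      using elim unfolding c_def infinity_ennreal_def less_top by assumption
    then have S: "0 \<le> S" "(\<Sum>i. ennreal (c i powr p)) = ennreal S"
      unfolding S_def by (simp_all only: enn2real_nonneg ennreal_enn2real)
    have "norm (f (s (Suc i)) x - f (s i) x) \<le> S powr (1 / p) * (1 / 2) ^ i" for i
    proof -
      have "sum (\<lambda>i. ennreal (c i powr p)) {i} \<le> (\<Sum>i. ennreal (c i powr p))"
        by (rule sum_le_suminf) simp_all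
      then have "ennreal (c i powr p) \<le> ennreal S" unfolding S(2) by simp
      then have "c i powr p \<le> S" using S(1) by (rule iffD1[OF ennreal_le_iff, rotated])
      then have "(c i powr p) powr (1 / p) \<le> S powr (1 / p)"
        using p by (intro powr_mono2) simp_all
      moreover have "(c i powr p) powr (1 / p) = c i"
        using p by (simp add: powr_powr c_def)
      ultimately have "c i * (1 / 2) ^ i \<le> S powr (1 / p) * (1 / 2) ^ i"
        by (intro mult_right_mono) simp_all
      moreover have "c i * (1 / 2) ^ i = norm (f (s (Suc i)) x - f (s i) x)"
        by (simp add: c_def power_one_over)
      ultimately show ?thesis by simp
    qed
    then have "convergent (\<lambda>i. f (s i) x)" by (rule convergent_if_geometric_steps)
    then show ?case unfolding g_def by (simp only: convergent_LIMSEQ_iff)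
  qed
  \<comment> \<open>Fatou's lemma along the subsequence lets the second index tend to infinity in
    the Cauchy estimate.\<close>
  have "(\<integral>\<^sup>+x. ennreal (norm (f k x - g x) powr p) \<partial>M) \<le> ennreal r"
    if M: "\<forall>j\<ge>m. \<forall>k\<ge>m. ?D j k \<le> ennreal r" and k: "m \<le> k" for m k r
  proof -
    have "AE x in M. ennreal (norm (f k x - g x) powr p)
        = liminf (\<lambda>i. ennreal (norm (f k x - f (s i) x) powr p))"
      using lim
    proof eventually_elim
      case (elim x)
      have "(\<lambda>i. ennreal (norm (f k x - f (s i) x) powr p)) \<longlonglongrightarrow> ennreal (norm (f k x - g x) powr p)"
        using p by (intro tendsto_ennrealI tendsto_powr' tendsto_norm tendsto_diff tendsto_const elim) auto
      then show ?case by (rule lim_imp_Liminf[OF sequentially_bot, symmetric])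
    qed
    then have "(\<integral>\<^sup>+x. ennreal (norm (f k x - g x) powr p) \<partial>M)
        = (\<integral>\<^sup>+x. liminf (\<lambda>i. ennreal (norm (f k x - f (s i) x) powr p)) \<partial>M)"
      by (rule nn_integral_cong_AE)
    also have "\<dots> \<le> liminf (\<lambda>i. ?D k (s i))"
      by (rule nn_integral_liminf) measurable
    also have "\<dots> \<le> limsup (\<lambda>i. ?D k (s i))"
      by (rule Liminf_le_Limsup) simp
    also have "\<dots> \<le> ennreal r"
    proof (rule Limsup_bounded)
      show "eventually (\<lambda>i. ?D k (s i) \<le> ennreal r) sequentially"
        using eventually_ge_at_top[of m]
        by eventually_elim (use M k s(3) in \<open>meson order_trans\<close>)
    qed
    finally show ?thesis .
  qed
  note bound = this
  have "(\<lambda>k. \<integral>\<^sup>+x. ennreal (norm (f k x - g x) powr p) \<partial>M) \<longlonglongrightarrow> 0"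
  proof (rule order_tendstoI)
    fix a :: ennreal
    assume "0 < a"
    then obtain d where d: "0 < ennreal d" "ennreal d < a"
      by (metis dense ennreal_cases less_top_ennreal order_less_trans)
    then obtain m where "\<forall>j\<ge>m. \<forall>k\<ge>m. ?D j k \<le> ennreal d"
      using Cauchy[of d] by auto
    from bound[OF this] d
    show "eventually (\<lambda>k. (\<integral>\<^sup>+x. ennreal (norm (f k x - g x) powr p) \<partial>M) < a) sequentially"
      unfolding eventually_sequentially by (meson le_less_trans)
  qed simp
  with g show ?thesis by blast
qed

section \<open>Elements of the completion\<close>

lemma C1_compact_diff:
  assumes "C1_compact u g" "C1_compact v h"
  shows "C1_compact (\<lambda>x. u x - v x) (\<lambda>x. g x - h x)"
proof -
  obtain R where R: "\<forall>x. norm x > R \<longrightarrow> u x = 0" using assms by (auto simp: C1_compact_def)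
  obtain S where S: "\<forall>x. norm x > S \<longrightarrow> v x = 0" using assms by (auto simp: C1_compact_def)
  have "\<exists>R. \<forall>x. norm x > R \<longrightarrow> u x - v x = 0"
    using R S by (intro exI[of _ "max R S"]) auto
  moreover have "GDERIV (\<lambda>x. u x - v x) x :> g x - h x" for x
    using assms by (intro GDERIV_diff) (auto simp: C1_compact_def)
  ultimately show ?thesis
    using assms by (auto simp: C1_compact_def intro: continuous_intros)
qed

text \<open>The case \<open>k = 1\<close> of smoothness gives continuity of each directional
  derivative separately; the gradient is assembled from those along the basis.\<close>

lemma C0_infinity_C1_compact:
  assumes "f \<in> C0_infinity"
  shows "\<exists>g. C1_compact f g"
proof -
  have "k_times_diff 1 f" and supp: "compact (closure {x. f x \<noteq> 0})"
    using assms by (auto simp: C0_infinity_def smooth_def)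
  then have diff: "f differentiable (at x)"
    and cont: "continuous_on UNIV (\<lambda>x. frechet_derivative f (at x) v)" for x v
    by auto
  define g where "g x = (\<Sum>b\<in>Basis. frechet_derivative f (at x) b *\<^sub>R b)" for x
  have "GDERIV f x :> g x" for x
  proof -
    have der: "(f has_derivative frechet_derivative f (at x)) (at x)"
      using diff frechet_derivative_works by blast
    then have lin: "linear (frechet_derivative f (at x))" by (rule has_derivative_linear)
    have "frechet_derivative f (at x) v = inner v (g x)" for v
    proof -
      have "frechet_derivative f (at x) v = frechet_derivative f (at x) (\<Sum>b\<in>Basis. inner v b *\<^sub>R b)"
        by (simp add: euclidean_representation)
      also have "\<dots> = inner v (g x)"
        using lin by (simp add: linear_sum linear_scale g_def inner_sum_right mult.commute)
      finally show ?thesis .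
    qed
    then have "frechet_derivative f (at x) = (\<lambda>v. inner v (g x))" by auto
    with der show ?thesis by (simp add: gderiv_def)
  qed
  moreover have "continuous_on UNIV g"
    unfolding g_def by (intro continuous_intros cont)
  moreover have "\<exists>R. \<forall>x. norm x > R \<longrightarrow> f x = 0"
  proof -
    obtain R where "\<forall>x\<in>closure {x. f x \<noteq> 0}. norm x \<le> R"
      using compact_imp_bounded[OF supp] by (auto simp: bounded_iff)
    then have "\<forall>x. norm x > R \<longrightarrow> f x = 0"
      using closure_subset[of "{x. f x \<noteq> 0}"] by fastforce
    then show ?thesis ..
  qed
  ultimately show ?thesis by (auto simp: C1_compact_def)
qed

lemma C0_infinity_half_C1_compact:
  assumes "\<phi> \<in> C0_infinity_half"
  shows "\<exists>f g. C1_compact f g \<and> (\<forall>x\<in>half_space. \<phi> x = f x)"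
proof -
  obtain f where f: "f \<in> C0_infinity" "\<phi> = (\<lambda>x. if x \<in> closed_half_space then f x else 0)"
    using assms by (auto simp: C0_infinity_half_def)
  then obtain g where "C1_compact f g" using C0_infinity_C1_compact by blast
  moreover have "\<forall>x\<in>half_space. \<phi> x = f x"
    using f by (auto simp: half_space_def closed_half_space_def)
  ultimately show ?thesis by blast
qed

text \<open>The half-space is open, so setting a function to \<open>0\<close> below the boundary
  does not affect derivatives inside.\<close>

lemma grad_half_space:
  assumes u: "C1_compact u g" and eq: "\<And>x. x \<in> half_space \<Longrightarrow> \<phi> x = u x" and x: "x \<in> half_space"
  shows "grad \<phi> x = g x"
proof -
  have "GDERIV \<phi> x :> g x"
    by (rule GDERIV_transform[OF C1_compact_GDERIV[OF u] half_space_open x]) (simp add: eq)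
  then show ?thesis
    unfolding grad_def by (blast intro: GDERIV_unique)
qed

text \<open>A bridge from Bochner integrals to nonnegative ones. The given \<open>f\<close> is
  controlled on the half-space only, while \<open>h\<close> is a Borel function on the whole
  space.\<close>

lemma set_integral_half_space:
  fixes f h :: "(real ^ 'n) \<times> real \<Rightarrow> real"
  assumes [measurable]: "h \<in> borel_measurable borel" and h: "\<And>x. 0 \<le> h x"
    and f: "\<And>x. x \<in> half_space \<Longrightarrow> f x = h x"
    and fin: "(\<integral>\<^sup>+x. ennreal (h x) \<partial>half_lborel) < top"
  shows "set_integrable lborel half_space f"
    and "(LINT x:half_space|lborel. f x) = enn2real (\<integral>\<^sup>+x. ennreal (h x) \<partial>half_lborel)"
proof -
  have eq: "(\<lambda>x. indicator half_space x *\<^sub>R f x) = (\<lambda>x. indicator half_space x * h x)"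
    using f by (auto simp: indicator_def)
  have int: "(\<integral>\<^sup>+x. ennreal (indicator half_space x * h x) \<partial>lborel) = (\<integral>\<^sup>+x. ennreal (h x) \<partial>half_lborel)"
    by (subst nn_integral_density) (auto intro!: nn_integral_cong simp: indicator_def)
  show "set_integrable lborel half_space f"
    unfolding set_integrable_def eq using fin h
    by (intro integrableI_nonneg) (auto simp: int)
  show "(LINT x:half_space|lborel. f x) = enn2real (\<integral>\<^sup>+x. ennreal (h x) \<partial>half_lborel)"
    unfolding set_lebesgue_integral_def eq int[symmetric] using h
    by (intro integral_eq_nn_integral) auto
qed

text \<open>Finite energy, due to \<open>-1 < \<alpha>\<close>, ensures that the Bochner integral
  inside \<open>D12_norm\<close> is the true value and not the default \<open>0\<close>.\<close>

lemma D12_norm_C1_compact: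
  fixes u :: "(real ^ 'n) \<times> real \<Rightarrow> real"
  assumes u: "C1_compact u g" and eq: "\<And>x. x \<in> half_space \<Longrightarrow> \<phi> x = u x" and \<alpha>: "-1 < \<alpha>"
  shows "(\<integral>\<^sup>+x. ennreal (snd x powr \<alpha> * (norm (g x))\<^sup>2) \<partial>half_lborel) = ennreal ((D12_norm \<alpha> \<phi>)\<^sup>2)"
proof -
  note [measurable] = C1_compact_borel[OF u]
  have fin: "(\<integral>\<^sup>+x. ennreal (snd x powr \<alpha> * (norm (g x))\<^sup>2) \<partial>half_lborel) < top"
    by (rule weighted_energy_finite[OF u \<alpha>])
  have "(LINT x:half_space|lborel. snd x powr \<alpha> * (norm (grad \<phi> x))\<^sup>2)
      = enn2real (\<integral>\<^sup>+x. ennreal (snd x powr \<alpha> * (norm (g x))\<^sup>2) \<partial>half_lborel)"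
    by (rule set_integral_half_space(2)[OF _ _ _ fin]) (auto simp: grad_half_space[OF u eq])
  then show ?thesis using fin by (simp add: D12_norm_def)
qed

lemma D12_norm_nonneg: "0 \<le> D12_norm \<alpha> \<phi>"
proof -
  have "0 \<le> (LINT x:half_space|lborel. snd x powr \<alpha> * (norm (grad \<phi> x))\<^sup>2)"
    unfolding set_lebesgue_integral_def by (intro integral_nonneg_AE) auto
  then show ?thesis by (simp add: D12_norm_def)
qed

text \<open>The zero function has norm \<open>0\<close>, so the sequence generating an equivalence
  class belongs to it; all other members differ from it by a null sequence.\<close>

lemma D12_representative:
  fixes U :: "(nat \<Rightarrow> (real ^ 'n) \<times> real \<Rightarrow> real) set"
  assumes "U \<in> D12 \<alpha>"
  shows "\<exists>\<phi>\<in>D12_Cauchy \<alpha>. \<phi> \<in> U \<and> (\<forall>\<psi>\<in>U. \<psi> \<in> D12_Cauchy \<alpha> \<and> 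
    (\<lambda>k. D12_norm \<alpha> (\<lambda>x. \<phi> k x - \<psi> k x)) \<longlonglongrightarrow> 0)"
proof -
  obtain \<phi> where \<phi>: "\<phi> \<in> D12_Cauchy \<alpha>" "U = D12_equiv \<alpha> `` {\<phi>}"
    using assms unfolding D12_def by (elim quotientE)
  have "grad (\<lambda>x. 0) x = 0" for x :: "(real ^ 'n) \<times> real"
    unfolding grad_def by (blast intro: GDERIV_const GDERIV_unique)
  then have "D12_norm \<alpha> (\<lambda>x::(real ^ 'n) \<times> real. 0) = 0"
    by (simp add: D12_norm_def)
  with \<phi> have "\<phi> \<in> U" by (simp add: D12_equiv_def)
  with \<phi> show ?thesis by (intro bexI[of _ \<phi>]) (auto simp: D12_equiv_def)
qed

section \<open>Weighted measures and convergence on compact sets\<close>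

text \<open>With the weight moved into the measure, weighted convergence becomes ordinary
  convergence in \<open>L^p\<close>, to which \<open>Lp_complete\<close> applies.\<close>

definition weight_measure :: "real \<Rightarrow> ((real ^ 'n) \<times> real) measure" where
  "weight_measure \<gamma> = density half_lborel (\<lambda>x. ennreal (snd x powr \<gamma>))"

lemma sets_weight_measure [measurable_cong, simp]: "sets (weight_measure \<gamma>) = sets borel"
  by (simp add: weight_measure_def)

lemma space_weight_measure [simp]: "space (weight_measure \<gamma>) = UNIV"
  by (simp add: weight_measure_def)

lemma nn_integral_weight_measure:
  fixes f :: "(real ^ 'n) \<times> real \<Rightarrow> real"
  assumes [measurable]: "f \<in> borel_measurable borel"
  shows "(\<integral>\<^sup>+x. ennreal (f x) \<partial>weight_measure \<gamma>) = (\<integral>\<^sup>+x. ennreal (snd x powr \<gamma> * f x) \<partial>half_lborel)"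
  unfolding weight_measure_def
  by (subst nn_integral_density, measurable) (simp add: ennreal_mult')

text \<open>The weight is positive on the open half-space, whatever the sign of
  \<open>\<gamma>\<close>, so the null sets do not change.\<close>

lemma AE_weight_measure_iff:
  assumes [measurable]: "Measurable.pred borel P"
  shows "(AE x in weight_measure \<gamma>. P x) \<longleftrightarrow> (AE x in half_lborel. P x)"
proof -
  have "(AE x in weight_measure \<gamma>. P x) \<longleftrightarrow> (AE x in half_lborel. 0 < ennreal (snd x powr \<gamma>) \<longrightarrow> P x)"
    unfolding weight_measure_def by (rule AE_density) measurable
  also have "\<dots> \<longleftrightarrow> (AE x in lborel. x \<in> half_space \<longrightarrow> 0 < ennreal (snd x powr \<gamma>) \<longrightarrow> P x)"
    by (subst AE_density) (auto simp: indicator_def)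
  also have "\<dots> \<longleftrightarrow> (AE x in lborel. x \<in> half_space \<longrightarrow> P x)"
    by (intro AE_cong) (auto simp: half_space_def)
  also have "\<dots> \<longleftrightarrow> (AE x in half_lborel. P x)"
    by (subst AE_density) (auto simp: indicator_def)
  finally show ?thesis .
qed

lemma nn_integral_weight_measure_eq_0:
  fixes f :: "(real ^ 'n) \<times> real \<Rightarrow> ennreal"
  assumes [measurable]: "f \<in> borel_measurable borel"
    and "(\<integral>\<^sup>+x. f x \<partial>weight_measure \<gamma>) = 0"
  shows "AE x in half_lborel. f x = 0"
proof -
  have "AE x in weight_measure \<gamma>. f x = 0"
    using assms(2) by (subst (asm) nn_integral_0_iff_AE) auto
  then show ?thesis by (subst (asm) AE_weight_measure_iff) auto
qed

text \<open>On a compact subset of the open half-space the weight has a positive minimum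
  \<open>m\<close>, and Hoelder's inequality on a set of finite measure bounds the
  \<open>L^1\<close> norm by the \<open>L^p\<close> norm.\<close>

lemma compact_tendsto_L1:
  fixes f :: "nat \<Rightarrow> (real ^ 'n) \<times> real \<Rightarrow> real"
  assumes [measurable]: "\<And>k. f k \<in> borel_measurable borel"
    and lim: "(\<lambda>k. \<integral>\<^sup>+x. ennreal (norm (f k x) powr p) \<partial>weight_measure \<beta>) \<longlonglongrightarrow> 0"
    and p: "1 \<le> p" and K: "compact K" "K \<subseteq> half_space"
  shows "(\<lambda>k. \<integral>\<^sup>+x\<in>K. ennreal \<bar>f k x\<bar> \<partial>lborel) \<longlonglongrightarrow> 0"
proof (cases "K = {}")
  case False
  have K_borel [measurable]: "K \<in> sets borel" using K by (simp add: borel_compact)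
  have pos: "0 < snd x" if "x \<in> K" for x using K that by (auto simp: half_space_def)
  have "continuous_on K (\<lambda>x. snd x powr \<beta>)"
    by (intro continuous_intros) (use pos in fastforce)
  then obtain z where z: "z \<in> K" "\<forall>x\<in>K. snd z powr \<beta> \<le> snd x powr \<beta>"
    using continuous_attains_inf[OF K(1) False] by blast
  define m where "m = snd z powr \<beta>"
  have m: "0 < m" "\<And>x. x \<in> K \<Longrightarrow> m \<le> snd x powr \<beta>"
    using z pos[of z] by (auto simp: m_def)
  let ?X = "\<lambda>k. \<integral>\<^sup>+x. ennreal (norm (f k x) powr p) \<partial>weight_measure \<beta>"
  let ?c = "epowr (emeasure lborel K) (1 - 1 / p)"
  have bound: "(\<integral>\<^sup>+x\<in>K. ennreal \<bar>f k x\<bar> \<partial>lborel) \<le> ?c * epowr (ennreal (1 / m) * ?X k) (1 / p)" for k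
  proof -
    \<comment> \<open>For \<open>p = 1\<close> the first factor is constantly \<open>1\<close>; the
      indicator inside the second factor still cuts off outside \<open>K\<close>.\<close>
    have "(\<integral>\<^sup>+x\<in>K. ennreal \<bar>f k x\<bar> \<partial>lborel)
        = (\<integral>\<^sup>+x. epowr (indicator K x) (1 - 1 / p) * epowr (indicator K x * ennreal (\<bar>f k x\<bar> powr p)) (1 / p) \<partial>lborel)"
      using p by (intro nn_integral_cong) (auto simp: indicator_def epowr_ennreal powr_powr)
    also have "\<dots> \<le> epowr (\<integral>\<^sup>+x. indicator K x \<partial>lborel) (1 - 1 / p)
        * epowr (\<integral>\<^sup>+x. indicator K x * ennreal (\<bar>f k x\<bar> powr p) \<partial>lborel) (1 / p)"
      using p by (intro nn_integral_Holder) auto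
    also have "\<dots> \<le> ?c * epowr (ennreal (1 / m) * ?X k) (1 / p)"
    proof (intro mult_mono epowr_mono)
      have "(\<integral>\<^sup>+x. indicator K x * ennreal (\<bar>f k x\<bar> powr p) \<partial>lborel)
          \<le> (\<integral>\<^sup>+x. ennreal (1 / m) * (indicator half_space x * ennreal (snd x powr \<beta> * \<bar>f k x\<bar> powr p)) \<partial>lborel)"
      proof (intro nn_integral_mono)
        fix x :: "(real ^ 'n) \<times> real"
        show "indicator K x * ennreal (\<bar>f k x\<bar> powr p)
          \<le> ennreal (1 / m) * (indicator half_space x * ennreal (snd x powr \<beta> * \<bar>f k x\<bar> powr p))"
        proof (cases "x \<in> K")
          case True
          have "1 * \<bar>f k x\<bar> powr p \<le> (1 / m * snd x powr \<beta>) * \<bar>f k x\<bar> powr p"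
            using m(1) m(2)[OF True] by (intro mult_right_mono) (auto simp: field_simps)
          moreover have "x \<in> half_space" using K True by blast
          ultimately show ?thesis
            using True m(1) by (simp add: ennreal_mult'[symmetric] mult.assoc ennreal_leI del: ennreal_mult'')
        qed simp
      qed
      also have "\<dots> = ennreal (1 / m) * ?X k"
        by (simp add: nn_integral_cmult nn_integral_weight_measure nn_integral_half_lborel mult.commute)
      finally show "(\<integral>\<^sup>+x. indicator K x * ennreal (\<bar>f k x\<bar> powr p) \<partial>lborel) \<le> ennreal (1 / m) * ?X k" .
    qed (use p in auto)
    finally show ?thesis .
  qed
  have "emeasure lborel K < top"
    using emeasure_bounded_finite[OF compact_imp_bounded[OF K(1)]] by simp
  then have c: "?c < top" by (metis epowr_eq_top_iff less_top)
  have "(\<lambda>k. ennreal (1 / m) * ?X k) \<longlonglongrightarrow> ennreal (1 / m) * 0"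
    by (intro ennreal_tendsto_cmult lim) simp
  then have "(\<lambda>k. epowr (ennreal (1 / m) * ?X k) (1 / p)) \<longlonglongrightarrow> 0"
    using p by (intro tendsto_epowr_0) auto
  then have "(\<lambda>k. ?c * epowr (ennreal (1 / m) * ?X k) (1 / p)) \<longlonglongrightarrow> ?c * 0"
    by (intro ennreal_tendsto_cmult c)
  then have "(\<lambda>k. ?c * epowr (ennreal (1 / m) * ?X k) (1 / p)) \<longlonglongrightarrow> 0" by simp
  then show ?thesis
    by (rule tendsto_sandwich[OF always_eventually always_eventually tendsto_const, rotated 2])
       (use bound in auto)
qed simp

text \<open>The half-space is exhausted by countably many compact sets, and the exceptional null
  sets are collected.\<close>

lemma AE_half_lborel_eqI:
  fixes u v :: "(real ^ 'n) \<times> real \<Rightarrow> real"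
  assumes [measurable]: "u \<in> borel_measurable borel" "v \<in> borel_measurable borel"
    and eq: "\<And>K. compact K \<Longrightarrow> K \<subseteq> half_space \<Longrightarrow> (\<integral>\<^sup>+x\<in>K. ennreal \<bar>u x - v x\<bar> \<partial>lborel) = 0"
  shows "AE x in half_lborel. u x = v x"
proof -
  define K where "K i = cball (0 :: (real ^ 'n) \<times> real) (real i) \<inter> {x. 1 / real (Suc i) \<le> snd x}" for i
  have "closed {x :: (real ^ 'n) \<times> real. 1 / real (Suc i) \<le> snd x}" for i
    by (intro closed_Collect_le continuous_intros)
  then have K: "compact (K i)" for i
    unfolding K_def by (intro compact_Int_closed compact_cball)
  have K_half: "K i \<subseteq> half_space" for i
  proof
    fix x assume "x \<in> K i"
    then have "1 / real (Suc i) \<le> snd x" by (simp add: K_def)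
    moreover have "0 < 1 / real (Suc i)" by simp
    ultimately show "x \<in> half_space" unfolding half_space_def mem_Collect_eq by linarith
  qed
  have [measurable]: "K i \<in> sets borel" for i using K by (simp add: borel_compact)
  have "AE x in lborel. ennreal \<bar>u x - v x\<bar> * indicator (K i) x = 0" for i
    using eq[OF K K_half, of i] by (subst (asm) nn_integral_0_iff_AE) auto
  then have "AE x in lborel. \<forall>i. ennreal \<bar>u x - v x\<bar> * indicator (K i) x = 0"
    by (intro AE_all_countable[THEN iffD2] allI)
  then have "AE x in lborel. x \<in> half_space \<longrightarrow> u x = v x"
  proof eventually_elim
    case (elim x)
    show ?case
    proof
      assume "x \<in> half_space"
      then have "0 < snd x" by (simp add: half_space_def)
      obtain a where a: "norm x \<le> real a" using real_arch_simple by blast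
      obtain b where b: "1 / real (Suc b) < snd x" using nat_approx_posE[OF \<open>0 < snd x\<close>] by blast
      have "1 / real (Suc (max a b)) \<le> 1 / real (Suc b)"
        by (intro divide_left_mono) auto
      with a b have "x \<in> K (max a b)" by (auto simp: K_def)
      with elim show "u x = v x" by (auto dest!: spec[of _ "max a b"])
    qed
  qed
  then show ?thesis by (subst AE_density) (auto simp: indicator_def)
qed

section \<open>Limits of Cauchy sequences and their inequality\<close>

text \<open>Applied to differences, the inequality turns a Cauchy sequence for the energy into one
  in weighted \<open>L^p\<close>; completeness then provides both the function and its gradient. The
  constant grows because limits are taken through the rootless triangle inequality:
  \<open>2 powr p\<close> comes from the functions, and \<open>8 = 4 * 2\<close> from the energies
  and the splitting of a sum under the power \<open>p / 2\<close>.\<close>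

lemma D12_limit:
  fixes U :: "(nat \<Rightarrow> (real ^ 'n) \<times> real \<Rightarrow> real) set"
  assumes \<alpha>: "-1 < \<alpha>" and p: "1 \<le> p" and C: "0 < C"
    and ineq: "\<And>u g. C1_compact (u :: (real ^ 'n) \<times> real \<Rightarrow> real) g \<Longrightarrow>
      (\<integral>\<^sup>+x. ennreal (snd x powr \<beta> * \<bar>u x\<bar> powr p) \<partial>half_lborel)
      \<le> ennreal C * epowr (\<integral>\<^sup>+x. ennreal (snd x powr \<alpha> * (norm (g x))\<^sup>2) \<partial>half_lborel) (p / 2)"
    and U: "U \<in> D12 \<alpha>"
  defines "K \<equiv> 2 powr p * C * (8 powr (p / 2))"
  shows "\<exists>u g. u \<in> borel_measurable borel \<and> g \<in> borel_measurable borel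
    \<and> represents_fun U u \<and> represents_grad \<alpha> U g
    \<and> (\<integral>\<^sup>+x. ennreal (norm (g x) powr 2) \<partial>weight_measure \<alpha>) < top
    \<and> (\<integral>\<^sup>+x. ennreal (norm (u x) powr p) \<partial>weight_measure \<beta>)
      \<le> ennreal K * epowr (\<integral>\<^sup>+x. ennreal (norm (g x) powr 2) \<partial>weight_measure \<alpha>) (p / 2)"
proof -
  have p0: "0 < p" using p by simp
  have energy: "(\<integral>\<^sup>+x. ennreal (norm (g x) powr 2) \<partial>weight_measure \<alpha>) = ennreal ((D12_norm \<alpha> \<phi>)\<^sup>2)"
    if u: "C1_compact u g" and eq: "\<And>x. x \<in> half_space \<Longrightarrow> \<phi> x = u x"
    for u :: "(real ^ 'n) \<times> real \<Rightarrow> real" and g \<phi>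
  proof -
    note [measurable] = C1_compact_borel[OF u]
    show ?thesis
      by (subst nn_integral_weight_measure, measurable)
         (simp add: powr_numeral D12_norm_C1_compact[OF u eq \<alpha>, symmetric])
  qed
  have power: "(\<integral>\<^sup>+x. ennreal (norm (u x) powr p) \<partial>weight_measure \<beta>) 
      \<le> ennreal C * epowr (\<integral>\<^sup>+x. ennreal (norm (g x) powr 2) \<partial>weight_measure \<alpha>) (p / 2)"
    if u: "C1_compact u g" for u :: "(real ^ 'n) \<times> real \<Rightarrow> real" and g
  proof -
    note [measurable] = C1_compact_borel[OF u]
    have "(\<integral>\<^sup>+x. ennreal (norm (u x) powr p) \<partial>weight_measure \<beta>)
        = (\<integral>\<^sup>+x. ennreal (snd x powr \<beta> * norm (u x) powr p) \<partial>half_lborel)"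
      "(\<integral>\<^sup>+x. ennreal (norm (g x) powr 2) \<partial>weight_measure \<alpha>)
        = (\<integral>\<^sup>+x. ennreal (snd x powr \<alpha> * norm (g x) powr 2) \<partial>half_lborel)"
      by (rule nn_integral_weight_measure; measurable)+
    with ineq[OF u] show ?thesis by (simp add: powr_numeral)
  qed
  obtain \<phi> where \<phi>: "\<phi> \<in> D12_Cauchy \<alpha>" "\<phi> \<in> U"
    and equiv: "\<And>\<psi>. \<psi> \<in> U \<Longrightarrow> \<psi> \<in> D12_Cauchy \<alpha>"
      "\<And>\<psi>. \<psi> \<in> U \<Longrightarrow> (\<lambda>k. D12_norm \<alpha> (\<lambda>x. \<phi> k x - \<psi> k x)) \<longlonglongrightarrow> 0"
    using D12_representative[OF U] by blast
  have smooth: "\<exists>F G. \<forall>k. C1_compact (F k) (G k) \<and> (\<forall>x\<in>half_space. \<psi> k x = F k x)"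
    if "\<psi> \<in> D12_Cauchy \<alpha>" for \<psi> :: "nat \<Rightarrow> (real ^ 'n) \<times> real \<Rightarrow> real"
  proof -
    have "\<forall>k. \<exists>f g. C1_compact f g \<and> (\<forall>x\<in>half_space. \<psi> k x = f x)"
      using that C0_infinity_half_C1_compact by (auto simp: D12_Cauchy_def)
    then show ?thesis by metis
  qed
  obtain F G where F: "\<And>k. C1_compact (F k) (G k)" "\<And>k x. x \<in> half_space \<Longrightarrow> \<phi> k x = F k x"
    using smooth[OF \<phi>(1)] by blast
  note [measurable] = C1_compact_borel[OF F(1)]
  \<comment> \<open>Hence a Cauchy sequence for \<open>D12_norm\<close> is a Cauchy sequence of
    gradients in weighted \<open>L^2\<close>.\<close>
  have G_diff: "(\<integral>\<^sup>+x. ennreal (norm (G j x - G k x) powr 2) \<partial>weight_measure \<alpha>)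
      = ennreal ((D12_norm \<alpha> (\<lambda>x. \<phi> j x - \<phi> k x))\<^sup>2)" for j k
    by (rule energy[OF C1_compact_diff[OF F(1) F(1)]]) (simp add: F(2))
  have Cauchy: "\<exists>N. \<forall>j\<ge>N. \<forall>k\<ge>N. D12_norm \<alpha> (\<lambda>x. \<phi> j x - \<phi> k x) < e" if "0 < e" for e
    using \<phi>(1) that by (auto simp: D12_Cauchy_def)
  have "\<exists>g\<in>borel_measurable (weight_measure \<alpha>).
      (\<lambda>k. \<integral>\<^sup>+x. ennreal (norm (G k x - g x) powr 2) \<partial>weight_measure \<alpha>) \<longlonglongrightarrow> 0"
  proof (rule Lp_complete)
    fix e :: real
    assume e: "0 < e"
    then obtain N where N: "\<forall>j\<ge>N. \<forall>k\<ge>N. D12_norm \<alpha> (\<lambda>x. \<phi> j x - \<phi> k x) < sqrt e"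
      using Cauchy[of "sqrt e"] by auto
    have "(D12_norm \<alpha> (\<lambda>x. \<phi> j x - \<phi> k x))\<^sup>2 \<le> e" if "N \<le> j" "N \<le> k" for j k
    proof -
      have "(D12_norm \<alpha> (\<lambda>x. \<phi> j x - \<phi> k x))\<^sup>2 \<le> (sqrt e)\<^sup>2"
        using N that by (intro power_mono D12_norm_nonneg less_imp_le) blast
      then show ?thesis using e by simp
    qed
    then show "\<exists>N. \<forall>j\<ge>N. \<forall>k\<ge>N. (\<integral>\<^sup>+x. ennreal (norm (G j x - G k x) powr 2) \<partial>weight_measure \<alpha>) \<le> ennreal e"
      unfolding G_diff by (intro exI[of _ N]) (simp add: ennreal_leI)
  qed simp_all
  then obtain g where g: "g \<in> borel_measurable borel"
    and G_lim: "(\<lambda>k. \<integral>\<^sup>+x. ennreal (norm (G k x - g x) powr 2) \<partial>weight_measure \<alpha>) \<longlonglongrightarrow> 0"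
    by (auto simp: measurable_cong_sets[OF sets_weight_measure refl])
  have "\<exists>u\<in>borel_measurable (weight_measure \<beta>).
      (\<lambda>k. \<integral>\<^sup>+x. ennreal (norm (F k x - u x) powr p) \<partial>weight_measure \<beta>) \<longlonglongrightarrow> 0"
  proof (rule Lp_complete)
    fix e :: real
    assume e: "0 < e"
    \<comment> \<open>The solution of \<open>C * d powr p = e\<close>, so that differences of energy
      norm below \<open>d\<close> have power integral at most \<open>e\<close>.\<close>
    define d where "d = (e / C) powr (1 / p)"
    have d: "0 < d" "C * d powr p = e" using e C p0 by (auto simp: d_def powr_powr)
    obtain N where N: "\<forall>j\<ge>N. \<forall>k\<ge>N. D12_norm \<alpha> (\<lambda>x. \<phi> j x - \<phi> k x) < d"
      using Cauchy[OF d(1)] by blast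
    have "(\<integral>\<^sup>+x. ennreal (norm (F j x - F k x) powr p) \<partial>weight_measure \<beta>) \<le> ennreal e"
      if "N \<le> j" "N \<le> k" for j k
    proof -
      let ?n = "D12_norm \<alpha> (\<lambda>x. \<phi> j x - \<phi> k x)"
      have n: "0 \<le> ?n" "?n \<le> d" using N that by (auto simp: D12_norm_nonneg intro: less_imp_le)
      have "(?n\<^sup>2) powr (p / 2) = ?n powr p"
        using n(1) by (simp add: powr_powr flip: powr_numeral)
      then have eq: "epowr (ennreal (?n\<^sup>2)) (p / 2) = ennreal (?n powr p)"
        using p0 by (simp add: epowr_ennreal)
      have "(\<integral>\<^sup>+x. ennreal (norm (F j x - F k x) powr p) \<partial>weight_measure \<beta>)
          \<le> ennreal C * ennreal (?n powr p)"
        using power[OF C1_compact_diff[OF F(1)[of j] F(1)[of k]]] unfolding G_diff eq .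
      also have "\<dots> = ennreal (C * ?n powr p)" using C by (simp add: ennreal_mult)
      also have "\<dots> \<le> ennreal (C * d powr p)"
        using n C p0 by (intro ennreal_leI mult_left_mono powr_mono2) auto
      finally show ?thesis by (simp only: d)
    qed
    then show "\<exists>N. \<forall>j\<ge>N. \<forall>k\<ge>N. (\<integral>\<^sup>+x. ennreal (norm (F j x - F k x) powr p) \<partial>weight_measure \<beta>) \<le> ennreal e"
      by blast
  qed (use p0 in simp_all)
  then obtain u where u: "u \<in> borel_measurable borel"
    and F_lim: "(\<lambda>k. \<integral>\<^sup>+x. ennreal (norm (F k x - u x) powr p) \<partial>weight_measure \<beta>) \<longlonglongrightarrow> 0"
    by (auto simp: measurable_cong_sets[OF sets_weight_measure refl])
  note [measurable] = u g
  have tri0: "(\<lambda>k. ennreal c * (X k + Y k)) \<longlonglongrightarrow> 0"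
    if "X \<longlonglongrightarrow> 0" "Y \<longlonglongrightarrow> 0" for X Y :: "nat \<Rightarrow> ennreal" and c
  proof -
    have "(\<lambda>k. ennreal c * (X k + Y k)) \<longlonglongrightarrow> ennreal c * (0 + 0)"
      by (intro ennreal_tendsto_cmult tendsto_add that) simp
    then show ?thesis by simp
  qed
  have le0: "X \<longlonglongrightarrow> 0" if "Y \<longlonglongrightarrow> 0" "\<And>k. X k \<le> Y k" for X Y :: "nat \<Rightarrow> ennreal"
    by (rule tendsto_sandwich[OF always_eventually always_eventually tendsto_const that(1)])
       (use that(2) in auto)
  \<comment> \<open>The limits found for \<open>\<phi>\<close> serve the whole class: gradients of
    any other member differ from those of \<open>\<phi>\<close> by a null sequence, and the
    inequality carries this over to the functions.\<close>
  have lims: "(\<lambda>k. \<integral>\<^sup>+x. ennreal (norm (F' k x - u x) powr p) \<partial>weight_measure \<beta>) \<longlonglongrightarrow> 0 \<and>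
      (\<lambda>k. \<integral>\<^sup>+x. ennreal (norm (G' k x - g x) powr 2) \<partial>weight_measure \<alpha>) \<longlonglongrightarrow> 0"
    if \<psi>: "\<psi> \<in> U" and F': "\<And>k. C1_compact (F' k) (G' k)" "\<And>k x. x \<in> half_space \<Longrightarrow> \<psi> k x = F' k x"
    for \<psi> F' G'
  proof -
    note [measurable] = C1_compact_borel[OF F'(1)]
    have GG: "(\<integral>\<^sup>+x. ennreal (norm (G' k x - G k x) powr 2) \<partial>weight_measure \<alpha>)
        = ennreal ((D12_norm \<alpha> (\<lambda>x. \<phi> k x - \<psi> k x))\<^sup>2)" for k
      using energy[OF C1_compact_diff[OF F(1)[of k] F'(1)[of k]], of "\<lambda>x. \<phi> k x - \<psi> k x"] 
      by (simp add: F(2) F'(2) norm_minus_commute)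
    have "(\<lambda>k. (D12_norm \<alpha> (\<lambda>x. \<phi> k x - \<psi> k x))\<^sup>2) \<longlonglongrightarrow> 0\<^sup>2"
      by (intro tendsto_power equiv \<psi>)
    then have GG_lim: "(\<lambda>k. \<integral>\<^sup>+x. ennreal (norm (G' k x - G k x) powr 2) \<partial>weight_measure \<alpha>) \<longlonglongrightarrow> 0"
      unfolding GG using tendsto_ennrealI by fastforce
    then have "(\<lambda>k. epowr (\<integral>\<^sup>+x. ennreal (norm (G' k x - G k x) powr 2) \<partial>weight_measure \<alpha>) (p / 2)) \<longlonglongrightarrow> 0"
      using p0 by (intro tendsto_epowr_0) auto
    then have FF_up: "(\<lambda>k. ennreal C * epowr (\<integral>\<^sup>+x. ennreal (norm (G' k x - G k x) powr 2) \<partial>weight_measure \<alpha>) (p / 2)) \<longlonglongrightarrow> 0"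
      using ennreal_tendsto_cmult[of "ennreal C"] by fastforce
    have FF_lim: "(\<lambda>k. \<integral>\<^sup>+x. ennreal (norm (F' k x - F k x) powr p) \<partial>weight_measure \<beta>) \<longlonglongrightarrow> 0"
      by (rule le0[OF FF_up]) (rule power[OF C1_compact_diff[OF F'(1) F(1)]])
    have "(\<lambda>k. \<integral>\<^sup>+x. ennreal (norm (F' k x - u x) powr p) \<partial>weight_measure \<beta>) \<longlonglongrightarrow> 0"
      by (rule le0[OF tri0[OF FF_lim F_lim]], rule nn_integral_norm_powr_triangle) (use p0 in simp_all)
    moreover have "(\<lambda>k. \<integral>\<^sup>+x. ennreal (norm (G' k x - g x) powr 2) \<partial>weight_measure \<alpha>) \<longlonglongrightarrow> 0"
      by (rule le0[OF tri0[OF GG_lim G_lim]], rule nn_integral_norm_powr_triangle) simp_all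
    ultimately show ?thesis ..
  qed
  have rep_u: "represents_fun U u"
    unfolding represents_fun_def
  proof (intro conjI ballI allI impI)
    show "set_borel_measurable lborel half_space u"
      unfolding set_borel_measurable_def by measurable
  next
    fix \<psi> and K :: "((real ^ 'n) \<times> real) set"
    assume \<psi>: "\<psi> \<in> U" and K: "compact K \<and> K \<subseteq> half_space"
    obtain F' G' where F': "\<And>k. C1_compact (F' k) (G' k)" "\<And>k x. x \<in> half_space \<Longrightarrow> \<psi> k x = F' k x"
      using smooth[OF equiv(1)[OF \<psi>]] by blast
    note [measurable] = C1_compact_borel[OF F'(1)]
    have "(\<integral>\<^sup>+x\<in>K. ennreal \<bar>\<psi> k x - u x\<bar> \<partial>lborel) = (\<integral>\<^sup>+x\<in>K. ennreal \<bar>F' k x - u x\<bar> \<partial>lborel)" for k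
      using K F'(2) by (intro nn_integral_cong) (auto simp: indicator_def subset_iff)
    moreover have "(\<lambda>k. \<integral>\<^sup>+x\<in>K. ennreal \<bar>F' k x - u x\<bar> \<partial>lborel) \<longlonglongrightarrow> 0"
      using lims[OF \<psi> F'] K p by (intro compact_tendsto_L1) auto
    ultimately show "(\<lambda>k. \<integral>\<^sup>+x\<in>K. ennreal \<bar>\<psi> k x - u x\<bar> \<partial>lborel) \<longlonglongrightarrow> 0" by simp
  qed
  have rep_g: "represents_grad \<alpha> U g"
    unfolding represents_grad_def
  proof (intro conjI ballI)
    show "set_borel_measurable lborel half_space g"
      unfolding set_borel_measurable_def by measurable
  next
    fix \<psi>
    assume \<psi>: "\<psi> \<in> U"
    obtain F' G' where F': "\<And>k. C1_compact (F' k) (G' k)" "\<And>k x. x \<in> half_space \<Longrightarrow> \<psi> k x = F' k x"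
      using smooth[OF equiv(1)[OF \<psi>]] by blast
    note [measurable] = C1_compact_borel[OF F'(1)]
    have "(\<integral>\<^sup>+x\<in>half_space. ennreal (snd x powr \<alpha> * (norm (grad (\<psi> k) x - g x))\<^sup>2) \<partial>lborel)
        = (\<integral>\<^sup>+x. ennreal (norm (G' k x - g x) powr 2) \<partial>weight_measure \<alpha>)" for k
    proof -
      have "(\<integral>\<^sup>+x\<in>half_space. ennreal (snd x powr \<alpha> * (norm (grad (\<psi> k) x - g x))\<^sup>2) \<partial>lborel)
          = (\<integral>\<^sup>+x\<in>half_space. ennreal (snd x powr \<alpha> * norm (G' k x - g x) powr 2) \<partial>lborel)"
        using grad_half_space[OF F'(1) F'(2)]
        by (intro nn_integral_cong) (auto simp: indicator_def powr_numeral)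
      then show ?thesis
        by (simp add: nn_integral_weight_measure nn_integral_half_lborel)
    qed
    then show "(\<lambda>k. \<integral>\<^sup>+x\<in>half_space. ennreal (snd x powr \<alpha> * (norm (grad (\<psi> k) x - g x))\<^sup>2) \<partial>lborel) \<longlonglongrightarrow> 0"
      using lims[OF \<psi> F'] by simp
  qed
  define A where "A = (\<integral>\<^sup>+x. ennreal (norm (g x) powr 2) \<partial>weight_measure \<alpha>)"
  define X where "X k = (\<integral>\<^sup>+x. ennreal (norm (F k x - u x) powr p) \<partial>weight_measure \<beta>)" for k
  define Y where "Y k = (\<integral>\<^sup>+x. ennreal (norm (G k x - g x) powr 2) \<partial>weight_measure \<alpha>)" for k
  have Y_lim: "Y \<longlonglongrightarrow> 0" unfolding Y_def[abs_def] by (rule G_lim)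
  have X_lim: "X \<longlonglongrightarrow> 0" unfolding X_def[abs_def] by (rule F_lim)
  define E where "E k = (\<integral>\<^sup>+x. ennreal (norm (G k x) powr 2) \<partial>weight_measure \<alpha>)" for k
  \<comment> \<open>This direction shows that the limiting energy \<open>A\<close> is finite; the
    reverse one, \<open>E_le\<close>, bounds the approximating energies in the final
    estimate.\<close>
  have A_le: "A \<le> ennreal 4 * (Y k + E k)" for k
    using nn_integral_norm_powr_triangle[where p=2 and a=g and b="G k" and c="\<lambda>_. 0" and M="weight_measure \<alpha>"]
    by (simp add: A_def Y_def E_def norm_minus_commute powr_numeral)
  have E_le: "E k \<le> ennreal 4 * (Y k + A)" for k
    using nn_integral_norm_powr_triangle[where p=2 and a="G k" and b=g and c="\<lambda>_. 0" and M="weight_measure \<alpha>"]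
    by (simp add: A_def Y_def E_def powr_numeral)
  have E_fin: "E k < top" for k
    unfolding E_def using energy[OF F(1)[of k], of "F k"] by simp
  have "A < top"
  proof -
    have "eventually (\<lambda>k. Y k < top) sequentially"
      using Y_lim by (rule order_tendstoD) simp
    then obtain k where "Y k < top" by (meson eventually_happens' sequentially_bot)
    then have "ennreal 4 * (Y k + E k) < top"
      using E_fin[of k] by (simp add: ennreal_mult_less_top)
    then show ?thesis using A_le[of k] by (rule le_less_trans[rotated])
  qed
  moreover have "(\<integral>\<^sup>+x. ennreal (norm (u x) powr p) \<partial>weight_measure \<beta>) \<le> ennreal K * epowr A (p / 2)"
  proof -
    have e8: "(4 :: real) powr (p / 2) * 2 powr (p / 2) = 8 powr (p / 2)"
      by (subst powr_mult[symmetric]) auto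
    define c where "c = C * 8 powr (p / 2)"
    have c: "0 \<le> c" "K = 2 powr p * c" using C by (auto simp: c_def K_def)
    \<comment> \<open>Everything on the right except the term with \<open>A\<close> tends to
      \<open>0\<close>, so the estimate survives as \<open>k\<close> tends to infinity.\<close>
    have bound: "(\<integral>\<^sup>+x. ennreal (norm (u x) powr p) \<partial>weight_measure \<beta>)
        \<le> ennreal (2 powr p) * (X k + ennreal c * (epowr (Y k) (p / 2) + epowr A (p / 2)))" for k
    proof -
      have "epowr (E k) (p / 2) \<le> epowr (ennreal 4 * (Y k + A)) (p / 2)"
        using p0 by (intro epowr_mono E_le) auto
      also have "\<dots> = ennreal (4 powr (p / 2)) * epowr (Y k + A) (p / 2)"
        using p0 by (subst epowr_mult) (auto simp: epowr_def)
      also have "epowr (Y k + A) (p / 2) \<le> ennreal (2 powr (p / 2)) * (epowr (Y k) (p / 2) + epowr A (p / 2))"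
        using p0 by (intro epowr_add_le) simp
      also have "ennreal (4 powr (p / 2)) * (ennreal (2 powr (p / 2)) * (epowr (Y k) (p / 2) + epowr A (p / 2)))
          = ennreal (8 powr (p / 2)) * (epowr (Y k) (p / 2) + epowr A (p / 2))"
        by (simp only: e8[symmetric] ennreal_mult powr_ge_zero mult.assoc)
      finally have E_pow: "epowr (E k) (p / 2) \<le> ennreal (8 powr (p / 2)) * (epowr (Y k) (p / 2) + epowr A (p / 2))"
        by (simp add: mult_left_mono)
      have "(\<integral>\<^sup>+x. ennreal (norm (u x) powr p) \<partial>weight_measure \<beta>)
          \<le> ennreal (2 powr p) * (X k + (\<integral>\<^sup>+x. ennreal (norm (F k x) powr p) \<partial>weight_measure \<beta>))"
        using nn_integral_norm_powr_triangle[where p=p and a=u and b="F k" and c="\<lambda>_. 0" and M="weight_measure \<beta>"] p0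
        by (simp add: X_def abs_minus_commute)
      also have "(\<integral>\<^sup>+x. ennreal (norm (F k x) powr p) \<partial>weight_measure \<beta>) \<le> ennreal C * epowr (E k) (p / 2)"
        unfolding E_def by (rule power[OF F(1)])
      also have "\<dots> \<le> ennreal C * (ennreal (8 powr (p / 2)) * (epowr (Y k) (p / 2) + epowr A (p / 2)))"
        by (intro mult_left_mono E_pow) simp
      also have "\<dots> = ennreal c * (epowr (Y k) (p / 2) + epowr A (p / 2))"
        using C by (simp add: c_def ennreal_mult mult.assoc)
      finally show ?thesis by (simp add: mult_left_mono add_left_mono)
    qed
    have "(\<lambda>k. epowr (Y k) (p / 2)) \<longlonglongrightarrow> 0"
      using p0 by (intro tendsto_epowr_0 Y_lim) simp
    then have "(\<lambda>k. ennreal (2 powr p) * (X k + ennreal c * (epowr (Y k) (p / 2) + epowr A (p / 2))))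
        \<longlonglongrightarrow> ennreal (2 powr p) * (0 + ennreal c * (0 + epowr A (p / 2)))"
      by (intro ennreal_tendsto_cmult tendsto_add tendsto_const X_lim) simp_all
    then have "(\<integral>\<^sup>+x. ennreal (norm (u x) powr p) \<partial>weight_measure \<beta>)
        \<le> ennreal (2 powr p) * (0 + ennreal c * (0 + epowr A (p / 2)))"
      by (rule LIMSEQ_le_const) (use bound in blast)
    also have "\<dots> = ennreal K * epowr A (p / 2)"
      using c by (simp add: ennreal_mult mult.assoc)
    finally show ?thesis .
  qed
  ultimately show ?thesis
    using rep_u rep_g u g unfolding A_def by blast
qed

section \<open>Independence of the chosen representatives, and the inequality on the
  completion\<close>

text \<open>Both functions are limits of one common sequence in \<open>L^1\<close> on compact sets.
  This transfers estimates to \<open>D12_fun\<close>, an arbitrary choice; the indicator is there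
  because a representative is unconstrained outside the half-space.\<close>

lemma represents_fun_AE_unique:
  assumes U: "U \<noteq> {}" "U \<subseteq> {\<psi>. \<forall>k. \<psi> k \<in> C0_infinity_half}"
    and rep: "represents_fun U u" "represents_fun U v"
  shows "AE x in half_lborel. indicator half_space x * u x = indicator half_space x * v x"
proof (rule AE_half_lborel_eqI)
  have meas: "(\<lambda>x. indicator half_space x * w x) \<in> borel_measurable borel" if "represents_fun U w" for w
    using that by (simp add: represents_fun_def set_borel_measurable_def)
  note [measurable] = meas[OF rep(1)] meas[OF rep(2)]
  show "(\<lambda>x. indicator half_space x * u x) \<in> borel_measurable borel"
    "(\<lambda>x. indicator half_space x * v x) \<in> borel_measurable borel"
    by measurable
  fix K :: "((real ^ 'a) \<times> real) set"
  assume K: "compact K" "K \<subseteq> half_space"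
  have [measurable]: "K \<in> sets borel" using K by (simp add: borel_compact)
  obtain \<psi> where \<psi>: "\<psi> \<in> U" "\<And>k. \<psi> k \<in> C0_infinity_half" using U by blast
  have \<psi>_meas: "(\<lambda>x. indicator half_space x * \<psi> k x) \<in> borel_measurable borel" for k
  proof -
    obtain f g where f: "C1_compact f g" "\<forall>x\<in>half_space. \<psi> k x = f x"
      using C0_infinity_half_C1_compact[OF \<psi>(2)] by blast
    note [measurable] = C1_compact_borel[OF f(1)]
    have "(\<lambda>x. indicator half_space x * \<psi> k x) = (\<lambda>x. indicator half_space x * f x)"
      using f(2) by (auto simp: indicator_def)
    then show ?thesis by simp
  qed
  note [measurable] = \<psi>_meas
  let ?I = "\<integral>\<^sup>+x\<in>K. ennreal \<bar>indicator half_space x * u x - indicator half_space x * v x\<bar> \<partial>lborel"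
  have le: "?I \<le> (\<integral>\<^sup>+x\<in>K. ennreal \<bar>\<psi> k x - u x\<bar> \<partial>lborel) + (\<integral>\<^sup>+x\<in>K. ennreal \<bar>\<psi> k x - v x\<bar> \<partial>lborel)" for k
  proof -
    let ?d = "\<lambda>w x. ennreal \<bar>indicator half_space x * \<psi> k x - indicator half_space x * w x\<bar> * indicator K x"
    have "?I \<le> (\<integral>\<^sup>+x. ?d u x + ?d v x \<partial>lborel)"
      by (intro nn_integral_mono)
         (auto simp: indicator_def ennreal_plus[symmetric] simp del: ennreal_plus intro!: ennreal_leI)
    also have "\<dots> = (\<integral>\<^sup>+x. ?d u x \<partial>lborel) + (\<integral>\<^sup>+x. ?d v x \<partial>lborel)"
      by (rule nn_integral_add) measurable
    finally have "?I \<le> (\<integral>\<^sup>+x. ?d u x \<partial>lborel) + (\<integral>\<^sup>+x. ?d v x \<partial>lborel)" .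
    moreover have "(\<integral>\<^sup>+x. ?d w x \<partial>lborel) = (\<integral>\<^sup>+x\<in>K. ennreal \<bar>\<psi> k x - w x\<bar> \<partial>lborel)" for w
      using K by (intro nn_integral_cong) (auto simp: indicator_def subset_iff)
    ultimately show ?thesis by simp
  qed
  have "(\<lambda>k. (\<integral>\<^sup>+x\<in>K. ennreal \<bar>\<psi> k x - u x\<bar> \<partial>lborel) + (\<integral>\<^sup>+x\<in>K. ennreal \<bar>\<psi> k x - v x\<bar> \<partial>lborel)) \<longlonglongrightarrow> 0 + 0"
    using rep \<psi>(1) K by (intro tendsto_add) (auto simp: represents_fun_def)
  then have "?I \<le> 0 + 0"
    by (rule LIMSEQ_le_const) (use le in blast)
  then show "?I = 0" by simp
qed

text \<open>The analogue for \<open>D12_grad\<close>: two weighted \<open>L^2\<close> limits of the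
  same gradients are at distance \<open>0\<close>, and the weight is positive.\<close>

lemma represents_grad_AE_unique:
  fixes U :: "(nat \<Rightarrow> (real ^ 'n) \<times> real \<Rightarrow> real) set"
  assumes U: "U \<noteq> {}" "U \<subseteq> {\<psi>. \<forall>k. \<psi> k \<in> C0_infinity_half}"
    and rep: "represents_grad \<alpha> U g" "represents_grad \<alpha> U h"
  shows "AE x in half_lborel. indicator half_space x *\<^sub>R g x = indicator half_space x *\<^sub>R h x"
proof -
  let ?w = "\<lambda>w x. indicator half_space x *\<^sub>R w x"
  have meas: "?w w \<in> borel_measurable borel" if "represents_grad \<alpha> U w" for w
    using that by (simp add: represents_grad_def set_borel_measurable_def)
  note [measurable] = meas[OF rep(1)] meas[OF rep(2)]
  obtain \<psi> where \<psi>: "\<psi> \<in> U" "\<And>k. \<psi> k \<in> C0_infinity_half" using U by blast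
  have "\<forall>k. \<exists>f g. C1_compact f g \<and> (\<forall>x\<in>half_space. \<psi> k x = f x)"
    using C0_infinity_half_C1_compact[OF \<psi>(2)] by blast
  then obtain F G where F: "\<And>k. C1_compact (F k) (G k)" "\<And>k x. x \<in> half_space \<Longrightarrow> \<psi> k x = F k x"
    by metis
  note [measurable] = C1_compact_borel[OF F(1)]
  have eq: "(\<integral>\<^sup>+x. ennreal (norm (?w w x - G k x) powr 2) \<partial>weight_measure \<alpha>)
      = (\<integral>\<^sup>+x\<in>half_space. ennreal (snd x powr \<alpha> * (norm (grad (\<psi> k) x - w x))\<^sup>2) \<partial>lborel)"
    if w: "represents_grad \<alpha> U w" for w k
  proof -
    note [measurable] = meas[OF w]
    have "(\<integral>\<^sup>+x. ennreal (norm (?w w x - G k x) powr 2) \<partial>weight_measure \<alpha>)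
        = (\<integral>\<^sup>+x\<in>half_space. ennreal (snd x powr \<alpha> * norm (?w w x - G k x) powr 2) \<partial>lborel)"
      by (simp add: nn_integral_weight_measure nn_integral_half_lborel)
    also have "\<dots> = (\<integral>\<^sup>+x\<in>half_space. ennreal (snd x powr \<alpha> * (norm (grad (\<psi> k) x - w x))\<^sup>2) \<partial>lborel)"
      using grad_half_space[OF F(1) F(2)]
      by (intro nn_integral_cong) (auto simp: indicator_def powr_numeral norm_minus_commute)
    finally show ?thesis .
  qed
  let ?I = "\<integral>\<^sup>+x. ennreal (norm (?w g x - ?w h x) powr 2) \<partial>weight_measure \<alpha>"
  let ?D = "\<lambda>w k. \<integral>\<^sup>+x\<in>half_space. ennreal (snd x powr \<alpha> * (norm (grad (\<psi> k) x - w x))\<^sup>2) \<partial>lborel"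
  have le: "?I \<le> ennreal (2 powr 2) * (?D g k + ?D h k)" for k
  proof -
    have "?I \<le> ennreal (2 powr 2) * ((\<integral>\<^sup>+x. ennreal (norm (?w g x - G k x) powr 2) \<partial>weight_measure \<alpha>)
        + (\<integral>\<^sup>+x. ennreal (norm (G k x - ?w h x) powr 2) \<partial>weight_measure \<alpha>))"
      by (rule nn_integral_norm_powr_triangle) simp_all
    also have "(\<integral>\<^sup>+x. ennreal (norm (G k x - ?w h x) powr 2) \<partial>weight_measure \<alpha>)
        = (\<integral>\<^sup>+x. ennreal (norm (?w h x - G k x) powr 2) \<partial>weight_measure \<alpha>)"
      by (simp only: norm_minus_commute)
    finally show ?thesis by (simp only: eq rep)
  qed
  have "(\<lambda>k. ennreal (2 powr 2) * (?D g k + ?D h k)) \<longlonglongrightarrow> ennreal (2 powr 2) * (0 + 0)"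
    using rep \<psi>(1) by (intro ennreal_tendsto_cmult tendsto_add) (auto simp: represents_grad_def)
  then have "?I \<le> ennreal (2 powr 2) * (0 + 0)"
    by (rule LIMSEQ_le_const) (use le in blast)
  then have "?I = 0" by simp
  then have "AE x in half_lborel. ennreal (norm (?w g x - ?w h x) powr 2) = 0"
    by (rule nn_integral_weight_measure_eq_0[rotated]) measurable
  then show ?thesis by eventually_elim simp
qed

text \<open>Integrability is asserted together with the inequality, because a nonintegrable function
  has Bochner integral \<open>0\<close> and would satisfy the inequality vacuously.\<close>

theorem corollary1p2:
  fixes n \<alpha> \<beta> p :: real
  defines "n \<equiv> real CARD('n::finite)"
  defines "p \<equiv> (2 * n + 2 * \<beta> + 2) / (n + \<alpha> - 1)"
  assumes "\<alpha> > 0" and "\<beta> > -1"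
    and "(n - 1) / (n + 1) * \<beta> \<le> \<alpha>" and "\<alpha> \<le> \<beta> + 2"
  shows "\<exists>C>0. \<forall>U \<in> (D12 \<alpha> :: (nat \<Rightarrow> (real ^ 'n) \<times> real \<Rightarrow> real) set set).
    set_integrable lborel half_space (\<lambda>x. snd x powr \<beta> * \<bar>D12_fun U x\<bar> powr p) \<and>
    (LINT x:half_space|lborel. snd x powr \<beta> * \<bar>D12_fun U x\<bar> powr p) powr (2 / p)
      \<le> C * (LINT x:half_space|lborel. snd x powr \<alpha> * (norm (D12_grad \<alpha> U x))\<^sup>2)"
proof -
  have n: "1 \<le> n" by (simp add: n_def Suc_le_eq)
  have d: "0 < n + \<alpha> - 1" using n assms(3) by simp
  \<comment> \<open>This follows from \<open>\<alpha> \<le> \<beta> + 2\<close> and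
    \<open>\<beta> > -1\<close>; convergence in \<open>L^1\<close> on compact sets depends on
    it.\<close>
  have p: "1 \<le> p" using d n assms(3-6) by (simp add: p_def)
  have "(n - 1) * \<beta> \<le> (n + 1) * \<alpha>" using n assms(5) by (simp add: field_simps)
  then obtain C where C: "0 < C" "\<And>u g. C1_compact (u :: (real ^ 'n) \<times> real \<Rightarrow> real) g \<Longrightarrow>
      (\<integral>\<^sup>+x. ennreal (snd x powr \<beta> * \<bar>u x\<bar> powr p) \<partial>half_lborel)
      \<le> ennreal C * epowr (\<integral>\<^sup>+x. ennreal (snd x powr \<alpha> * (norm (g x))\<^sup>2) \<partial>half_lborel) (p / 2)"
    using weighted_inequality_C1[where 'n='n, of \<alpha> \<beta>] assms unfolding n_def p_def by blast
  define K where "K = 2 powr p * C * (8 powr (p / 2))"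
  have K: "0 < K" using C(1) by (simp add: K_def)
  show ?thesis
  \<comment> \<open>The limit estimate has the factor \<open>K\<close> and the power
    \<open>p / 2\<close> of the energy; raising it to the power \<open>2 / p\<close> makes the
    energy linear and yields this constant.\<close>
  proof (intro exI[of _ "K powr (2 / p)"] conjI ballI)
    show "0 < K powr (2 / p)" using K by simp
  next
    fix U :: "(nat \<Rightarrow> (real ^ 'n) \<times> real \<Rightarrow> real) set"
    assume U: "U \<in> D12 \<alpha>"
    have \<alpha>1: "-1 < \<alpha>" using assms(3) by simp
    obtain u g where [measurable]: "u \<in> borel_measurable borel" "g \<in> borel_measurable borel"
      and rep: "represents_fun U u" "represents_grad \<alpha> U g"
      and fin: "(\<integral>\<^sup>+x. ennreal (norm (g x) powr 2) \<partial>weight_measure \<alpha>) < top"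
      and le: "(\<integral>\<^sup>+x. ennreal (norm (u x) powr p) \<partial>weight_measure \<beta>)
        \<le> ennreal K * epowr (\<integral>\<^sup>+x. ennreal (norm (g x) powr 2) \<partial>weight_measure \<alpha>) (p / 2)"
      using D12_limit[OF \<alpha>1 p C U] unfolding K_def by blast
    have U': "U \<noteq> {}" "U \<subseteq> {\<psi>. \<forall>k. \<psi> k \<in> C0_infinity_half}"
      using D12_representative[OF U] by (auto simp: D12_Cauchy_def)
    have rep': "represents_fun U (D12_fun U)" "represents_grad \<alpha> U (D12_grad \<alpha> U)"
      unfolding D12_fun_def D12_grad_def
      using someI[of "represents_fun U", OF rep(1)] someI[of "represents_grad \<alpha> U", OF rep(2)] by blast+
    \<comment> \<open>Cut off to the half-space, the chosen representatives become Borel functions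
      on the whole space.\<close>
    define v where "v x = indicator half_space x * D12_fun U x" for x
    define w where "w x = indicator half_space x *\<^sub>R D12_grad \<alpha> U x" for x
    have [measurable]: "v \<in> borel_measurable borel" "w \<in> borel_measurable borel"
      using rep' by (simp_all add: represents_fun_def represents_grad_def set_borel_measurable_def v_def[abs_def] w_def[abs_def])
    have half: "AE x in half_lborel. x \<in> half_space"
      by (subst AE_density) (auto simp: indicator_def)
    have v_int: "(\<integral>\<^sup>+x. ennreal (snd x powr \<beta> * \<bar>v x\<bar> powr p) \<partial>half_lborel)
        = (\<integral>\<^sup>+x. ennreal (norm (u x) powr p) \<partial>weight_measure \<beta>)" (is "?V = _")
    proof -
      have "AE x in half_lborel. v x = u x"
        using represents_fun_AE_unique[OF U' rep'(1) rep(1)] half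
        by eventually_elim (simp add: v_def)
      then have "?V = (\<integral>\<^sup>+x. ennreal (snd x powr \<beta> * \<bar>u x\<bar> powr p) \<partial>half_lborel)"
        by (intro nn_integral_cong_AE) auto
      then show ?thesis by (simp add: nn_integral_weight_measure)
    qed
    have w_int: "(\<integral>\<^sup>+x. ennreal (snd x powr \<alpha> * (norm (w x))\<^sup>2) \<partial>half_lborel)
        = (\<integral>\<^sup>+x. ennreal (norm (g x) powr 2) \<partial>weight_measure \<alpha>)" (is "?W = _")
    proof -
      have "AE x in half_lborel. w x = g x"
        using represents_grad_AE_unique[OF U' rep'(2) rep(2)] half
        by eventually_elim (simp add: w_def)
      then have "?W = (\<integral>\<^sup>+x. ennreal (snd x powr \<alpha> * (norm (g x))\<^sup>2) \<partial>half_lborel)"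
        by (intro nn_integral_cong_AE) auto
      then show ?thesis by (simp add: nn_integral_weight_measure powr_numeral)
    qed
    \<comment> \<open>Because the energy is finite, \<open>a\<close> is its true value, and so is
      the Bochner integral on the right-hand side.\<close>
    define a where "a = enn2real ?W"
    have a: "0 \<le> a" "?W = ennreal a" using fin by (simp_all add: a_def w_int)
    have V_le: "?V \<le> ennreal (K * a powr (p / 2))"
    proof -
      have "?V \<le> ennreal K * epowr (ennreal a) (p / 2)"
        using le unfolding v_int w_int[symmetric] a(2) .
      then show ?thesis using a(1) K p by (simp add: epowr_ennreal ennreal_mult)
    qed
    then have V_fin: "?V < top" by (rule le_less_trans) simp
    have V: "set_integrable lborel half_space (\<lambda>x. snd x powr \<beta> * \<bar>D12_fun U x\<bar> powr p)"
      "(LINT x:half_space|lborel. snd x powr \<beta> * \<bar>D12_fun U x\<bar> powr p) = enn2real ?V"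
      by (rule set_integral_half_space[OF _ _ _ V_fin], measurable, simp, simp add: v_def)+
    have W_fin: "?W < top" by (simp add: a)
    have W: "(LINT x:half_space|lborel. snd x powr \<alpha> * (norm (D12_grad \<alpha> U x))\<^sup>2) = a"
      unfolding a_def
      by (rule set_integral_half_space(2)[OF _ _ _ W_fin], measurable, simp, simp add: w_def)
    show "set_integrable lborel half_space (\<lambda>x. snd x powr \<beta> * \<bar>D12_fun U x\<bar> powr p)"
      by (rule V(1))
    have "enn2real ?V \<le> K * a powr (p / 2)"
      using enn2real_mono[OF V_le] K by simp
    then have "enn2real ?V powr (2 / p) \<le> (K * a powr (p / 2)) powr (2 / p)"
      using p by (intro powr_mono2) auto
    also have "\<dots> = K powr (2 / p) * a"
      using a(1) p by (simp add: powr_mult powr_powr)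
    finally show "(LINT x:half_space|lborel. snd x powr \<beta> * \<bar>D12_fun U x\<bar> powr p) powr (2 / p)
        \<le> K powr (2 / p) * (LINT x:half_space|lborel. snd x powr \<alpha> * (norm (D12_grad \<alpha> U x))\<^sup>2)"
      unfolding V(2) W .
  qed
qed

end
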